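(* Consider the Poisson problem $-\Delta u(x,y)=1$, $(x,y)\in[0,1]^2$, with boundary conditions $u(0,y)=u(1,y)=0$ in the $x$-direction and periodic boundary conditions in the $y$-direction, whose solution is $u(x,y)=\frac12x(1-x)$. For integers $m\ge n\ge 1$ let $u_{n,m}$ be the nonconforming P1 Galerkin solution of this problem with respect to the triangulation $\mathcal{T}_{n,m}$. Then there is a constant $C$, independent of $n$ and $m$, such that $$ |u-u_{n,m}|_{H^1,\mathcal{T}_{n,m}}\le \frac{C}{n}\qquad\text{for all integers } m\ge n\ge 1. $$
   Context: **Triangulations.** For integers $m\ge n\ge 1$, $\mathcal{T}_{n,m}$ is the triangulation of $[0,1]^2$ into closed triangles generated by intersecting $[0,1]^2$ with the three systems of lines $y=\frac{j}{2m}$ ($j=1,\dots,2m-1$); $y=\frac nm x+\frac jm$ ($j=1-m,\dots,m-1$); $y=-\frac nm x+\frac jm$ ($j=1,\dots,2m-1$). Its vertices are the points $P_{i,j}=(\frac{i}{2n},\frac{j}{2m})$, where $i=0,2,\dots,2n$ if $j\in\{0,2,\dots,2m\}$ is even, and $i=0,1,3,\dots,2n-1,2n$ if $j\in\{1,3,\dots,2m-1\}$ is odd. **Nonconforming P1 space (for the present boundary conditions).** $V_{n,m}$ is the space of functions $v$ that are a linear polynomial on each triangle of $\mathcal{T}_{n,m}$ (in general discontinuous across edges), are continuous across the midpoints of interior edges, vanish at the midpoints of the boundary edges on the lines $x=0$ and $x=1$, and are periodic in $y$ in the sense that the values of $v$ at the midpoints of each pair of corresponding boundary edges on $y=0$ and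 $y=1$ (same $x$-coordinates) coincide. **Discrete norm.** For $v$ with $v|_\Delta\in H^1(\Delta)$ for all $\Delta\in\mathcal{T}_{n,m}$, $|v|_{H^1,\mathcal{T}_{n,m}}=\big(\sum_{\Delta\in\mathcal{T}_{n,m}}\int_\Delta|\nabla v|^2\,dxdy\big)^{1/2}$, with associated bilinear form $(v,w)_{H^1,\mathcal{T}_{n,m}}=\sum_{\Delta\in\mathcal{T}_{n,m}}\int_\Delta \nabla v\cdot\nabla w\,dxdy$. **Galerkin solution.** $u_{n,m}\in V_{n,m}$ is the unique element with $(u_{n,m},v)_{H^1,\mathcal{T}_{n,m}}=(1,v)_{L_2([0,1]^2)}$ for all $v\in V_{n,m}$. *)

theory Defs
  imports "HOL-Analysis.Analysis"
begin

definition grad :: "(real \<times> real \<Rightarrow> real) \<Rightarrow> real \<times> real \<Rightarrow> real \<times> real" where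
  "grad f p = (THE D. GDERIV f p :> D)"

definition hess_vec :: "(real \<times> real \<Rightarrow> real) \<Rightarrow> real \<times> real \<Rightarrow> real \<times> real \<Rightarrow> real \<times> real" where
  "hess_vec f p b = frechet_derivative (grad f) (at p) b"

definition C2_on :: "(real \<times> real) set \<Rightarrow> (real \<times> real \<Rightarrow> real) \<Rightarrow> bool" where
  "C2_on S f \<longleftrightarrow>
     (\<forall>p\<in>S. f differentiable (at p) \<and> grad f differentiable (at p)) \<and>
     (\<forall>b\<in>Basis. continuous_on S (\<lambda>p. hess_vec f p b))"

definition laplacian :: "(real \<times> real \<Rightarrow> real) \<Rightarrow> real \<times> real \<Rightarrow> real" where
  "laplacian f p = (\<Sum>b\<in>Basis. hess_vec f p b \<bullet> b)"

text \<open>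
  Periodic boundary conditions in \<open>y\<close> are expressed, as usual, by posing the problem for
  the 1-periodic extension in \<open>y\<close>, that is, on the strip \<open>0 \<le> x \<le> 1\<close>.
\<close>

definition poisson_solution :: "(real \<times> real \<Rightarrow> real) \<Rightarrow> bool" where
  "poisson_solution u \<longleftrightarrow>
     continuous_on ({0..1} \<times> UNIV) u \<and>
     C2_on ({0<..<1} \<times> UNIV) u \<and>
     (\<forall>p\<in>{0<..<1} \<times> UNIV. - laplacian u p = 1) \<and>
     (\<forall>y. u (0, y) = 0 \<and> u (1, y) = 0) \<and>
     (\<forall>x\<in>{0..1}. \<forall>y. u (x, y + 1) = u (x, y))"

definition unit_square :: "(real \<times> real) set" where
  "unit_square = {0..1} \<times> {0..1}"

definition mesh_lines :: "nat \<Rightarrow> nat \<Rightarrow> (real \<times> real) set set" where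
  "mesh_lines n m =
     {{(x, y). y = real_of_int j / (2 * real m)} | j. j \<in> {1..2 * int m - 1}} \<union>
     {{(x, y). y = real n / real m * x + real_of_int j / real m} | j. j \<in> {1 - int m..int m - 1}} \<union>
     {{(x, y). y = - (real n / real m) * x + real_of_int j / real m} | j. j \<in> {1..2 * int m - 1}}"

text \<open>
  The closed triangles are the closures of the cells into which the lines cut the open square.
\<close>

definition triangulation :: "nat \<Rightarrow> nat \<Rightarrow> (real \<times> real) set set" where
  "triangulation n m = closure ` components (interior unit_square - \<Union> (mesh_lines n m))"

text \<open>
  A broken function is a family \<open>v\<close> indexed by triangles, where \<open>v \<Delta>\<close> represents the
  restriction to \<open>\<Delta>\<close>, so that it may have different values on an edge from its two sides.
  Only the values \<open>v \<Delta> p\<close> with \<open>\<Delta>\<close> in the triangulation and \<open>p \<in> \<Delta>\<close> are relevant.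
\<close>

type_synonym broken_fun = "(real \<times> real) set \<Rightarrow> real \<times> real \<Rightarrow> real"

definition linear_poly_on :: "(real \<times> real) set \<Rightarrow> (real \<times> real \<Rightarrow> real) \<Rightarrow> bool" where
  "linear_poly_on S f \<longleftrightarrow> (\<exists>a b c. \<forall>(x, y)\<in>S. f (x, y) = a + b * x + c * y)"

definition continuous_at_interior_midpoints :: "nat \<Rightarrow> nat \<Rightarrow> broken_fun \<Rightarrow> bool" where
  "continuous_at_interior_midpoints n m v \<longleftrightarrow>
     (\<forall>T\<in>triangulation n m. \<forall>T'\<in>triangulation n m. \<forall>a b.
        closed_segment a b edge_of T \<longrightarrow> closed_segment a b edge_of T' \<longrightarrow>
        \<not> closed_segment a b \<subseteq> frontier unit_square \<longrightarrow>
        v T (midpoint a b) = v T' (midpoint a b))"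

definition vanishes_at_lateral_midpoints :: "nat \<Rightarrow> nat \<Rightarrow> broken_fun \<Rightarrow> bool" where
  "vanishes_at_lateral_midpoints n m v \<longleftrightarrow>
     (\<forall>T\<in>triangulation n m. \<forall>a b.
        closed_segment a b edge_of T \<longrightarrow>
        closed_segment a b \<subseteq> {0} \<times> UNIV \<or> closed_segment a b \<subseteq> {1} \<times> UNIV \<longrightarrow>
        v T (midpoint a b) = 0)"

definition periodic_at_midpoints :: "nat \<Rightarrow> nat \<Rightarrow> broken_fun \<Rightarrow> bool" where
  "periodic_at_midpoints n m v \<longleftrightarrow>
     (\<forall>T\<in>triangulation n m. \<forall>T'\<in>triangulation n m. \<forall>x x'.
        closed_segment (x, 0) (x', 0) edge_of T \<longrightarrow>
        closed_segment (x, 1) (x', 1) edge_of T' \<longrightarrow>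
        v T (midpoint (x, 0) (x', 0)) = v T' (midpoint (x, 1) (x', 1)))"

definition nonconforming_P1 :: "nat \<Rightarrow> nat \<Rightarrow> broken_fun set" where
  "nonconforming_P1 n m =
     {v. (\<forall>T\<in>triangulation n m. linear_poly_on T (v T)) \<and>
         continuous_at_interior_midpoints n m v \<and>
         vanishes_at_lateral_midpoints n m v \<and>
         periodic_at_midpoints n m v}"

definition broken_H1_form :: "nat \<Rightarrow> nat \<Rightarrow> broken_fun \<Rightarrow> broken_fun \<Rightarrow> real" where
  "broken_H1_form n m v w =
     (\<Sum>T\<in>triangulation n m. integral T (\<lambda>p. grad (v T) p \<bullet> grad (w T) p))"

definition broken_H1_seminorm :: "nat \<Rightarrow> nat \<Rightarrow> broken_fun \<Rightarrow> real" where
  "broken_H1_seminorm n m v =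
     sqrt (\<Sum>T\<in>triangulation n m. integral T (\<lambda>p. (norm (grad (v T) p))\<^sup>2))"

text \<open>The right-hand side is the \<open>L\<^sub>2\<close> product of \<open>v\<close> with the constant function 1, split over the triangles.\<close>

definition galerkin_solution :: "nat \<Rightarrow> nat \<Rightarrow> broken_fun \<Rightarrow> bool" where
  "galerkin_solution n m w \<longleftrightarrow>
     w \<in> nonconforming_P1 n m \<and>
     (\<forall>v\<in>nonconforming_P1 n m.
        broken_H1_form n m w v = (\<Sum>T\<in>triangulation n m. integral T (\<lambda>p. 1 * v T p)))"

end

theory Submission
  imports Defs
begin

text \<open>
  The exact solution is identified by the maximum principle on the strip, which is compact
  modulo the period in \<open>y\<close>.

  The triangles have width at most \<open>1/n\<close> and height \<open>1/(2m)\<close>; as \<open>m/n\<close> is unbounded their largest angle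
  may tend to \<open>\<pi>\<close>, so the usual interpolation estimates are not uniform. The error bound
  holds all the same because \<open>\<nabla>u = (1/2 - x, 0)\<close> is so special, through two observations.

  First, let the interpolant of \<open>u\<close> take at each edge midpoint the mean of \<open>u\<close> over that edge. By the
  divergence theorem its gradient on a triangle is the mean of \<open>\<nabla>u\<close> there, which is \<open>(1/2 - x\<^sub>T, 0)\<close>
  with \<open>x\<^sub>T\<close> the abscissa of the centroid. It differs from \<open>\<nabla>u\<close> by at most the width of the
  triangle, whatever the height (\<open>interpolant_at_midpoint\<close>, \<open>interpolant_in_nonconforming_P1\<close>).

  Second, the lowest order Raviart-Thomas field \<open>\<tau>\<close> with the same flux as \<open>\<nabla>u\<close> through every edge has
  divergence \<open>-1\<close> and constant normal component on each edge. Hence Green's formula on each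
  triangle sees \<open>v\<close> on an edge only through its midpoint value, the edge terms cancel for nonconforming \<open>v\<close>,
  and \<open>(\<tau>, \<nabla>v) = (1, v)\<close>. So \<open>\<tau> - \<nabla>u_nm\<close> is orthogonal to the broken gradients, and the distance
  between \<open>u_nm\<close> and the interpolant is at most the distance between \<open>\<tau>\<close> and the gradient of the
  interpolant. Since \<open>\<nabla>v\<close> is piecewise constant, only the value of \<open>\<tau>\<close> at the centroid
  matters (\<open>mean_flux\<close>), and an exact computation shows that this value is within \<open>O(1/n + 1/m)\<close> of
  \<open>(1/2 - x\<^sub>T, 0)\<close> (\<open>mean_flux_minus_interpolant_slope\<close>). The flux of \<open>\<nabla>u\<close> through horizontal edges
  vanishes, so the cancellation is a telescoping sum along each row of triangles
  (\<open>row_flux_cancels\<close>).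

  Both facts need the cells of the line arrangement explicitly: they are the
  interiors of \<open>2m\<close> rows of \<open>2n + 1\<close> triangles (\<open>triangulation_eq\<close>).
\<close>

section \<open>The exact solution\<close>

lemma grad_eqI:
  assumes "(f has_derivative (\<lambda>h. h \<bullet> D)) (at p)"
  shows "grad f p = D"
proof -
  have unique: "D' = D" if "GDERIV f p :> D'" for D'
  proof -
    have "(\<lambda>h. h \<bullet> D') = (\<lambda>h. h \<bullet> D)"
      using that assms has_derivative_unique unfolding gderiv_def by blast
    then show ?thesis by (metis vector_eq_ldot)
  qed
  show ?thesis
    unfolding grad_def by (rule the_equality[OF _ unique]) (use assms in \<open>simp add: gderiv_def\<close>)
qed

lemma has_derivative_grad:
  assumes "f differentiable (at p)"
  shows "(f has_derivative (\<lambda>h. h \<bullet> grad f p)) (at p)"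
proof -
  obtain f' where f': "(f has_derivative f') (at p)"
    using assms unfolding differentiable_def by blast
  then have "linear f'" by (rule has_derivative_linear)
  define D where "D = adjoint f' 1"
  have "f' h = h \<bullet> D" for h
    unfolding D_def by (simp only: adjoint_works[OF \<open>linear f'\<close>] inner_real_def mult_1_right)
  then have "f' = (\<lambda>h. h \<bullet> D)" by (rule ext)
  then have D: "(f has_derivative (\<lambda>h. h \<bullet> D)) (at p)"
    using f' by (simp only:)
  then show ?thesis unfolding grad_eqI[OF D] .
qed

lemma second_derivative_nonpos_at_max:
  fixes \<phi> \<phi>' :: "real \<Rightarrow> real"
  assumes "\<delta> > 0"
    and d1: "\<And>t. \<bar>t\<bar> < \<delta> \<Longrightarrow> (\<phi> has_real_derivative \<phi>' t) (at t)"
    and d2: "(\<phi>' has_real_derivative D) (at 0)"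
    and max: "\<And>t. \<bar>t\<bar> < \<delta> \<Longrightarrow> \<phi> t \<le> \<phi> 0"
  shows "D \<le> 0"
proof (rule ccontr)
  assume "\<not> D \<le> 0"
  then have "0 < D" by simp
  from DERIV_pos_inc_right[OF d2 this]
  obtain e where e: "e > 0" "\<forall>h>0. h < e \<longrightarrow> \<phi>' 0 < \<phi>' (0 + h)" by blast
  have "\<phi>' 0 = 0"
    using DERIV_local_max[OF d1 \<open>\<delta> > 0\<close>, of 0] max \<open>\<delta> > 0\<close> by auto
  define t where "t = min e \<delta> / 2"
  have t: "0 < t" "t < e" "t < \<delta>" using e \<open>\<delta> > 0\<close> by (auto simp: t_def)
  obtain z where z: "0 < z" "z < t" "\<phi> t - \<phi> 0 = (t - 0) * \<phi>' z"
    using MVT2[of 0 t \<phi> \<phi>'] d1 t by auto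
  have "\<phi>' z > 0" using e(2)[rule_format, of z] z t \<open>\<phi>' 0 = 0\<close> by simp
  then have "\<phi> t > \<phi> 0" using z t by (smt (verit) mult_pos_pos)
  with max[of t] t show False by auto
qed

text \<open>
  The quadratic perturbation is what the maximum principle needs: it absorbs both the
  comparison with the parabola and the strictly convex term \<open>\<epsilon> x\<^sup>2\<close>, neither of which has to be
  differentiated as a function on the plane.
\<close>

lemma hess_nonpos_at_max:
  assumes "open S" "p \<in> S"
    and f: "\<And>q. q \<in> S \<Longrightarrow> f differentiable (at q)"
    and gf: "grad f differentiable (at p)"
    and max: "\<And>t. p + t *\<^sub>R b \<in> S \<Longrightarrow> s * f (p + t *\<^sub>R b) + \<alpha> * t + \<beta> * t\<^sup>2 \<le> s * f p"
  shows "s * (hess_vec f p b \<bullet> b) + 2 * \<beta> \<le> 0"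
proof -
  have "open ((\<lambda>t. p + t *\<^sub>R b) -` S)"
    by (intro open_vimage \<open>open S\<close> continuous_intros)
  moreover have "0 \<in> (\<lambda>t. p + t *\<^sub>R b) -` S" using \<open>p \<in> S\<close> by simp
  ultimately obtain \<delta> where \<delta>: "\<delta> > 0" "\<And>t. dist t 0 < \<delta> \<Longrightarrow> p + t *\<^sub>R b \<in> S"
    unfolding open_dist by (metis vimageD)
  let ?\<phi> = "\<lambda>t. s * f (p + t *\<^sub>R b) + \<alpha> * t + \<beta> * t\<^sup>2"
  let ?\<phi>' = "\<lambda>t. s * (b \<bullet> grad f (p + t *\<^sub>R b)) + \<alpha> + 2 * \<beta> * t"
  have line: "((\<lambda>t. p + t *\<^sub>R b) has_derivative (\<lambda>h. h *\<^sub>R b)) (at t)" for t :: real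
    by (auto intro!: derivative_eq_intros)
  have d1: "(?\<phi> has_real_derivative ?\<phi>' t) (at t)" if "\<bar>t\<bar> < \<delta>" for t
  proof -
    have "((\<lambda>t. f (p + t *\<^sub>R b)) has_derivative (\<lambda>h. (h *\<^sub>R b) \<bullet> grad f (p + t *\<^sub>R b))) (at t)"
      using has_derivative_compose[OF line has_derivative_grad[OF f[OF \<delta>(2)]]] that by simp
    then have "((\<lambda>t. f (p + t *\<^sub>R b)) has_real_derivative (b \<bullet> grad f (p + t *\<^sub>R b))) (at t)"
      by (simp add: has_field_derivative_def mult.commute[of "b \<bullet> _"] mult_commute_abs)
    then show ?thesis by (auto intro!: derivative_eq_intros)
  qed
  have d2: "(?\<phi>' has_real_derivative (s * (hess_vec f p b \<bullet> b) + 2 * \<beta>)) (at 0)"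
  proof -
    let ?H = "frechet_derivative (grad f) (at p)"
    have H: "(grad f has_derivative ?H) (at (p + 0 *\<^sub>R b))"
      using gf by (simp add: frechet_derivative_works)
    have "((\<lambda>t. grad f (p + t *\<^sub>R b)) has_derivative (\<lambda>h. ?H (h *\<^sub>R b))) (at 0)"
      using has_derivative_compose[OF line H] by simp
    then have "((\<lambda>t. b \<bullet> grad f (p + t *\<^sub>R b)) has_derivative (\<lambda>h. b \<bullet> ?H (h *\<^sub>R b))) (at 0)"
      by (rule has_derivative_inner_right)
    moreover have "b \<bullet> ?H (h *\<^sub>R b) = (hess_vec f p b \<bullet> b) * h" for h
      using H[THEN has_derivative_linear] by (simp add: linear_cmul hess_vec_def inner_commute)
    ultimately have "((\<lambda>t. b \<bullet> grad f (p + t *\<^sub>R b)) has_real_derivative (hess_vec f p b \<bullet> b)) (at 0)"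
      by (simp add: has_field_derivative_def)
    then show ?thesis by (auto intro!: derivative_eq_intros)
  qed
  show ?thesis
    by (rule second_derivative_nonpos_at_max[OF \<open>\<delta> > 0\<close> d1 d2]) (use max \<delta> in auto)
qed

lemma Basis_real_prod: "(Basis :: (real \<times> real) set) = {(1, 0), (0, 1)}"
  by (auto simp: Basis_prod_def)

lemma laplacian_eq: "laplacian f p = hess_vec f p (1, 0) \<bullet> (1, 0) + hess_vec f p (0, 1) \<bullet> (0, 1)"
  by (simp add: laplacian_def Basis_real_prod)

lemma poisson_solution_periodic_int:
  assumes "poisson_solution u" "x \<in> {0..1}"
  shows "u (x, y + of_int k) = u (x, y)"
proof -
  have per: "u (x, y + 1) = u (x, y)" for y using assms by (auto simp: poisson_solution_def)
  have nat: "u (x, y + of_nat j) = u (x, y)" for y j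
    by (induction j) (use per[of "y + of_nat _"] in \<open>auto simp: algebra_simps\<close>)
  show ?thesis
    using nat[of y "nat k"] nat[of "y + of_int k" "nat (- k)"] by (cases "k \<ge> 0") auto
qed

text \<open>
  At an interior maximum of the left-hand side both second derivatives would be nonpositive, while their
  sum is \<open>2 \<epsilon>\<close>. So the maximum over one period, which exists by compactness, lies on one of the
  lines \<open>x = 0\<close> and \<open>x = 1\<close>. The sign \<open>s\<close> gives the upper and the lower bound at once.
\<close>

lemma poisson_maximum_principle:
  assumes u: "poisson_solution u" and s: "s = 1 \<or> s = -1" and "\<epsilon> > 0" and x: "x \<in> {0..1}"
  shows "s * (u (x, y) - 1 / 2 * x * (1 - x)) + \<epsilon> * x\<^sup>2 \<le> \<epsilon>"
proof -
  define \<psi> where "\<psi> = (\<lambda>p. s * (u p - 1 / 2 * fst p * (1 - fst p)) + \<epsilon> * (fst p)\<^sup>2)"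
  let ?K = "{0..1::real} \<times> {0..1::real}"
  have "continuous_on ?K u"
    using u by (auto simp: poisson_solution_def intro: continuous_on_subset)
  then have "continuous_on ?K \<psi>"
    unfolding \<psi>_def by (intro continuous_intros)
  moreover have "compact ?K" by (intro compact_Times compact_Icc)
  ultimately obtain p where p: "p \<in> ?K" "\<And>q. q \<in> ?K \<Longrightarrow> \<psi> q \<le> \<psi> p"
    using continuous_attains_sup[of ?K \<psi>] by auto
  have le: "\<psi> (x, y) \<le> \<psi> p" if "x \<in> {0..1}" for x y
  proof -
    have "u (x, frac y) = u (x, y)"
      using poisson_solution_periodic_int[OF u that, of "frac y" "\<lfloor>y\<rfloor>"] by (simp add: frac_def)
    then have "\<psi> (x, y) = \<psi> (x, frac y)" by (simp add: \<psi>_def)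
    also have "\<dots> \<le> \<psi> p" using that by (intro p) (auto simp: less_imp_le[OF frac_lt_1])
    finally show ?thesis .
  qed
  obtain x0 y0 where p_eq: "p = (x0, y0)" by (cases p)
  have "x0 = 0 \<or> x0 = 1"
  proof (rule ccontr)
    assume "\<not> (x0 = 0 \<or> x0 = 1)"
    with p(1) p_eq have x0: "0 < x0" "x0 < 1" by auto
    define S where "S = {0<..<1::real} \<times> (UNIV :: real set)"
    have S: "open S" "p \<in> S" using x0 p_eq by (auto simp: S_def open_Times)
    have f: "u differentiable (at q)" and gf: "grad u differentiable (at q)" if "q \<in> S" for q
      using u that by (auto simp: poisson_solution_def C2_on_def S_def)
    have A: "s * (hess_vec u p (1, 0) \<bullet> (1, 0)) + 2 * (s / 2 + \<epsilon>) \<le> 0"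
    proof (rule hess_nonpos_at_max[OF S f gf[OF S(2)]])
      fix t :: real assume "p + t *\<^sub>R (1, 0) \<in> S"
      then have "x0 + t \<in> {0..1}" by (auto simp: p_eq S_def)
      from le[OF this, of y0]
      show "s * u (p + t *\<^sub>R (1, 0)) + (s * (x0 - 1 / 2) + 2 * \<epsilon> * x0) * t + (s / 2 + \<epsilon>) * t\<^sup>2 \<le> s * u p"
        by (simp add: \<psi>_def p_eq algebra_simps power2_eq_square add_divide_distrib diff_divide_distrib)
    qed
    have B: "s * (hess_vec u p (0, 1) \<bullet> (0, 1)) + 2 * 0 \<le> 0"
    proof (rule hess_nonpos_at_max[OF S f gf[OF S(2)]])
      fix t :: real
      show "s * u (p + t *\<^sub>R (0, 1)) + 0 * t + 0 * t\<^sup>2 \<le> s * u p"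
        using le[of x0 "y0 + t"] x0 by (simp add: \<psi>_def p_eq algebra_simps)
    qed
    have "laplacian u p = -1"
      using u S(2) unfolding poisson_solution_def S_def by (metis minus_equation_iff)
    then have "s * (hess_vec u p (1, 0) \<bullet> (1, 0)) + s * (hess_vec u p (0, 1) \<bullet> (0, 1)) = - s"
      unfolding laplacian_eq by (metis distrib_left mult.right_neutral mult_minus_right)
    with A B \<open>\<epsilon> > 0\<close> show False by auto
  qed
  then have "\<psi> p \<le> \<epsilon>"
    using u \<open>\<epsilon> > 0\<close> by (auto simp: \<psi>_def p_eq poisson_solution_def)
  with le[OF x, of y] show ?thesis by (simp add: \<psi>_def)
qed

lemma poisson_solution_unique:
  assumes u: "poisson_solution u" and x: "x \<in> {0..1}"
  shows "u (x, y) = 1 / 2 * x * (1 - x)"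
proof -
  have le: "s * (u (x, y) - 1 / 2 * x * (1 - x)) \<le> 0" if "s = 1 \<or> s = -1" for s
  proof (rule field_le_epsilon)
    fix \<epsilon> :: real assume "\<epsilon> > 0"
    then show "s * (u (x, y) - 1 / 2 * x * (1 - x)) \<le> 0 + \<epsilon>"
      using poisson_maximum_principle[OF u that \<open>\<epsilon> > 0\<close> x, of y] zero_le_power2[of x]
      by (smt (verit) mult_nonneg_nonneg)
  qed
  from le[of 1] le[of "-1"] show ?thesis by auto
qed

lemma has_derivative_parabola:
  fixes u :: "real \<times> real \<Rightarrow> real"
  assumes u: "\<And>x y. x \<in> {0..1} \<Longrightarrow> u (x, y) = 1 / 2 * x * (1 - x)"
    and p: "p \<in> {0<..<1} \<times> UNIV"
  shows "(u has_derivative (\<lambda>h. h \<bullet> (1 / 2 - fst p, 0))) (at p)"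
proof -
  have op: "open ({0<..<1::real} \<times> (UNIV :: real set))" by (intro open_Times) auto
  have "((\<lambda>p. 1 / 2 * fst p * (1 - fst p)) has_derivative (\<lambda>h. h \<bullet> (1 / 2 - fst p, 0))) (at p)"
    by (auto intro!: derivative_eq_intros simp: inner_prod_def field_simps)
  then show ?thesis
    by (rule has_derivative_transform_within_open[OF _ op p]) (auto simp: u)
qed

text \<open>
  Outside the strip \<open>u\<close> is arbitrary, so the derivatives are taken through the open strip, on which
  \<open>u\<close> agrees with the parabola.
\<close>

lemma poisson_solution_parabola:
  assumes u: "\<And>x y. x \<in> {0..1} \<Longrightarrow> u (x, y) = 1 / 2 * x * (1 - x)"
  shows "poisson_solution u"
proof -
  let ?S = "{0<..<1::real} \<times> (UNIV :: real set)"
  have op: "open ?S" by (intro open_Times) auto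
  have gr: "grad u p = (1 / 2 - fst p, 0)" if "p \<in> ?S" for p
    by (rule grad_eqI[OF has_derivative_parabola[OF u that]])
  have dg: "(grad u has_derivative (\<lambda>h. (- fst h, 0))) (at p)" if "p \<in> ?S" for p
  proof -
    have "((\<lambda>p. (1 / 2 - fst p, 0)) has_derivative (\<lambda>h. (- fst h, 0))) (at p)"
      by (auto intro!: derivative_eq_intros)
    then show ?thesis
      by (rule has_derivative_transform_within_open[OF _ op that]) (auto simp: gr)
  qed
  have hs: "hess_vec u p b = (- fst b, 0)" if "p \<in> ?S" for p b
    unfolding hess_vec_def by (metis frechet_derivative_at[OF dg[OF that]])
  have "continuous_on ({0..1} \<times> UNIV) u"
  proof -
    have "continuous_on ({0..1} \<times> (UNIV::real set)) (\<lambda>p. 1 / 2 * fst p * (1 - fst p :: real))"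
      by (intro continuous_intros)
    then show ?thesis
      by (subst continuous_on_cong[OF refl]) (auto simp: u)
  qed
  moreover have "C2_on ?S u"
    unfolding C2_on_def
  proof (intro conjI ballI)
    fix p assume p: "p \<in> ?S"
    show "u differentiable at p" using has_derivative_parabola[OF u p] by (auto simp: differentiable_def)
    show "grad u differentiable at p" using dg[OF p] by (auto simp: differentiable_def)
  next
    fix b :: "real \<times> real"
    have "continuous_on ?S (\<lambda>p. (- fst b, 0 :: real))" by simp
    then show "continuous_on ?S (\<lambda>p. hess_vec u p b)"
      by (subst continuous_on_cong[OF refl]) (auto simp: hs)
  qed
  moreover have "laplacian u p = -1" if "p \<in> ?S" for p
    by (simp only: laplacian_eq hs[OF that]) simp
  ultimately show ?thesis
    by (auto simp: poisson_solution_def u)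
qed

lemma poisson_solution_iff:
  "poisson_solution u \<longleftrightarrow> (\<forall>x\<in>{0..1}. \<forall>y. u (x, y) = 1 / 2 * x * (1 - x))"
  using poisson_solution_unique poisson_solution_parabola by blast

section \<open>Segments, edges and components\<close>

text \<open>
  The end points are recovered as the extreme points of the segment.
\<close>

lemma closed_segment_eq_iff:
  fixes a b c d :: "'a::euclidean_space"
  shows "closed_segment a b = closed_segment c d \<longleftrightarrow> {a, b} = {c, d}"
proof
  assume "closed_segment a b = closed_segment c d"
  then have "x = a \<or> x = b \<longleftrightarrow> x = c \<or> x = d" for x
    by (metis extreme_point_of_segment)
  then show "{a, b} = {c, d}" by auto
next
  assume "{a, b} = {c, d}"
  then show "closed_segment a b = closed_segment c d"
    by (metis segment_convex_hull)
qed

lemma closed_segment_edge_of_triangle_iff: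
  fixes A B C :: "'a::euclidean_space"
  assumes nc: "\<not> collinear {A, B, C}"
  shows "closed_segment a b edge_of convex hull {A, B, C} \<longleftrightarrow>
    {a, b} = {A, B} \<or> {a, b} = {A, C} \<or> {a, b} = {B, C}"
proof -
  have ABC: "A \<noteq> B" "A \<noteq> C" "B \<noteq> C" and ind: "\<not> affine_dependent {A, B, C}"
    using nc by (auto simp: collinear_3_eq_affine_dependent)
  have face: "F face_of convex hull {A, B, C} \<longleftrightarrow> (\<exists>c\<subseteq>{A, B, C}. F = convex hull c)" for F
    using face_of_convex_hull_affine_independent[OF ind] .
  show ?thesis
  proof
    assume "closed_segment a b edge_of convex hull {A, B, C}"
    then obtain c where c: "c \<subseteq> {A, B, C}" "closed_segment a b = convex hull c"
      and dim: "aff_dim (closed_segment a b) = 1"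
      unfolding edge_of_def face by blast
    have "int (card c) = 2"
    proof -
      have "\<not> affine_dependent c" using ind c(1) affine_dependent_subset by blast
      then show ?thesis
        using dim c(2) aff_dim_affine_independent[of c] by (simp add: aff_dim_convex_hull)
    qed
    then obtain p q where pq: "c = {p, q}" by (auto simp: card_2_iff)
    then have "{a, b} = {p, q}"
      using c(2) closed_segment_eq_iff by (metis segment_convex_hull)
    moreover have "p \<noteq> q" using \<open>int (card c) = 2\<close> pq by auto
    ultimately show "{a, b} = {A, B} \<or> {a, b} = {A, C} \<or> {a, b} = {B, C}"
      using c(1) pq by auto
  next
    assume *: "{a, b} = {A, B} \<or> {a, b} = {A, C} \<or> {a, b} = {B, C}"
    then have "{a, b} \<subseteq> {A, B, C}" and "a \<noteq> b"
      using ABC by (auto simp: doubleton_eq_iff)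
    then have "convex hull {a, b} face_of convex hull {A, B, C}"
      unfolding face by blast
    then show "closed_segment a b edge_of convex hull {A, B, C}"
      using \<open>a \<noteq> b\<close> by (simp add: edge_of_def segment_convex_hull aff_dim_convex_hull)
  qed
qed

text \<open>
  No connected set can meet two of the pieces, since one piece and the union of the others
  separate it.
\<close>

lemma components_of_open_connected_partition:
  fixes \<C> :: "'a::topological_space set set"
  assumes op: "\<And>C. C \<in> \<C> \<Longrightarrow> open C" and con: "\<And>C. C \<in> \<C> \<Longrightarrow> connected C"
    and ne: "{} \<notin> \<C>" and disj: "disjoint \<C>"
  shows "components (\<Union> \<C>) = \<C>"
proof -
  have comp: "connected_component_set (\<Union> \<C>) x = C" if "C \<in> \<C>" "x \<in> C" for C x
  proof (rule connected_component_unique)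
    fix D assume D: "x \<in> D" "D \<subseteq> \<Union> \<C>" "connected D"
    have "open C" "open (\<Union> (\<C> - {C}))" using op that by auto
    moreover have "C \<inter> \<Union> (\<C> - {C}) = {}"
      using disj that by (fastforce simp: disjoint_def)
    moreover have "D \<subseteq> C \<union> \<Union> (\<C> - {C})" using D that by auto
    ultimately have "C \<inter> D = {} \<or> \<Union> (\<C> - {C}) \<inter> D = {}"
      using connectedD[OF D(3), of C "\<Union> (\<C> - {C})"] by blast
    then show "D \<subseteq> C" using D that by blast
  qed (use that con in auto)
  show ?thesis
  proof
    show "components (\<Union> \<C>) \<subseteq> \<C>"
      using comp by (auto simp: components_def)
    show "\<C> \<subseteq> components (\<Union> \<C>)"
    proof
      fix C assume "C \<in> \<C>"
      with ne obtain x where "x \<in> C" by (cases "C = {}") auto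
      with comp \<open>C \<in> \<C>\<close> show "C \<in> components (\<Union> \<C>)"
        unfolding components_def by blast
    qed
  qed
qed

section \<open>Triangles with a horizontal side\<close>

text \<open>
  With \<open>\<theta>\<close> the relative height below the apex, the barycentric coordinates are read off from the horizontal
  slice at that height. Both the interior and the triangle itself follow from this by sign conditions.
\<close>

lemma barycentric_horizontal_base:
  fixes xA yA xB xC yB :: real
  assumes "yA \<noteq> yB" "xB < xC"
  shows "\<alpha> + \<beta> + \<gamma> = 1 \<and> \<alpha> *\<^sub>R (xA, yA) + \<beta> *\<^sub>R (xB, yB) + \<gamma> *\<^sub>R (xC, yB) = (x, y) \<longleftrightarrow>
    (let \<theta> = (y - yA) / (yB - yA) in
      \<alpha> = 1 - \<theta> \<and> \<beta> = (xA + \<theta> * (xC - xA) - x) / (xC - xB) \<and>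
      \<gamma> = (x - (xA + \<theta> * (xB - xA))) / (xC - xB))" (is "?L \<longleftrightarrow> ?R")
proof
  define \<theta> where "\<theta> = (y - yA) / (yB - yA)"
  have y: "y = yA + \<theta> * (yB - yA)" using assms by (simp add: \<theta>_def)
  assume L: ?L
  then have a: "\<alpha> = 1 - (\<beta> + \<gamma>)" by simp
  from L have x: "x = xA + \<beta> * (xB - xA) + \<gamma> * (xC - xA)" and "y = yA + (\<beta> + \<gamma>) * (yB - yA)"
    by (simp_all add: a algebra_simps)
  with y assms have th: "\<theta> = \<beta> + \<gamma>" by simp
  have "\<beta> * (xC - xB) = xA + \<theta> * (xC - xA) - x" "\<gamma> * (xC - xB) = x - (xA + \<theta> * (xB - xA))"
    by (simp_all add: x th algebra_simps)
  then show ?R using assms th a by (simp add: Let_def \<theta>_def[symmetric] field_simps)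
next
  define \<theta> where "\<theta> = (y - yA) / (yB - yA)"
  have y: "y = yA + \<theta> * (yB - yA)" using assms by (simp add: \<theta>_def)
  assume ?R
  then have a: "\<alpha> = 1 - \<theta>" and b: "\<beta> = (xA + \<theta> * (xC - xA) - x) / (xC - xB)"
    and c: "\<gamma> = (x - (xA + \<theta> * (xB - xA))) / (xC - xB)"
    by (simp_all add: Let_def \<theta>_def)
  have "\<beta> * (xC - xB) = xA + \<theta> * (xC - xA) - x"
    using assms by (simp add: b)
  have c': "\<gamma> * (xC - xB) = x - (xA + \<theta> * (xB - xA))"
    using assms by (simp add: c)
  have "(\<beta> + \<gamma>) * (xC - xB) = \<theta> * (xC - xB)"
    unfolding distrib_right c' \<open>\<beta> * (xC - xB) = _\<close> by (simp add: algebra_simps)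
  with assms have th: "\<beta> = \<theta> - \<gamma>" by simp
  have "x = xA + \<theta> * (xB - xA) + \<gamma> * (xC - xB)" using c' by simp
  then show ?L
    by (simp add: a th y algebra_simps)
qed

lemma not_collinear_horizontal_base:
  fixes xA yA xB xC yB :: real
  assumes "yA \<noteq> yB" "xB < xC"
  shows "\<not> collinear {(xA, yA), (xB, yB), (xC, yB)}"
proof
  assume "collinear {(xA, yA), (xB, yB), (xC, yB)}"
  then have "collinear {(xB, yB), (xC, yB), (xA, yA)}"
    by (simp add: insert_commute)
  then have "(xA, yA) \<in> affine hull {(xB, yB), (xC, yB)}"
    using assms by (intro collinear_3_imp_in_affine_hull) auto
  then obtain s t where "s + t = 1" "yA = s * yB + t * yB" by (auto simp: affine_hull_2)
  then show False using assms by (metis distrib_right mult_1)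
qed

text \<open>
  The bounds on \<open>x\<close> force \<open>\<theta> > 0\<close>.
\<close>

lemma interior_triangle_horizontal_base:
  fixes xA yA xB xC yB :: real
  assumes "yA \<noteq> yB" "xB < xC"
  shows "interior (convex hull {(xA, yA), (xB, yB), (xC, yB)}) =
    {(x, y). let \<theta> = (y - yA) / (yB - yA) in \<theta> < 1 \<and>
      xA + \<theta> * (xB - xA) < x \<and> x < xA + \<theta> * (xC - xA)}"
proof -
  let ?P = "\<lambda>\<alpha> \<beta> \<gamma> p. \<alpha> + \<beta> + \<gamma> = 1 \<and> \<alpha> *\<^sub>R (xA, yA) + \<beta> *\<^sub>R (xB, yB) + \<gamma> *\<^sub>R (xC, yB) = p"
  have "interior (convex hull {(xA, yA), (xB, yB), (xC, yB)}) =
    {(x, y). \<exists>\<alpha> \<beta> \<gamma>. 0 < \<alpha> \<and> 0 < \<beta> \<and> 0 < \<gamma> \<and> ?P \<alpha> \<beta> \<gamma> (x, y)}"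
  proof -
    have split: "{v. Q v} = {(x, y). Q (x, y)}" for Q :: "real \<times> real \<Rightarrow> bool" by auto
    have "DIM(real \<times> real) = 2" by simp
    from interior_convex_hull_3_minimal[OF not_collinear_horizontal_base[OF assms] this]
    show ?thesis by (rule trans[OF _ split])
  qed
  also have "\<dots> = {(x, y). let \<theta> = (y - yA) / (yB - yA) in \<theta> < 1 \<and>
      xA + \<theta> * (xB - xA) < x \<and> x < xA + \<theta> * (xC - xA)}"
    unfolding barycentric_horizontal_base[OF assms] Let_def
    using assms by (auto simp: zero_less_divide_iff)
  finally show ?thesis .
qed

lemma triangle_horizontal_base:
  fixes xA yA xB xC yB :: real
  assumes "yA \<noteq> yB" "xB < xC"
  shows "convex hull {(xA, yA), (xB, yB), (xC, yB)} =
    {(x, y). let \<theta> = (y - yA) / (yB - yA) in \<theta> \<le> 1 \<and>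
      xA + \<theta> * (xB - xA) \<le> x \<and> x \<le> xA + \<theta> * (xC - xA)}"
proof -
  let ?P = "\<lambda>\<alpha> \<beta> \<gamma> p. \<alpha> + \<beta> + \<gamma> = 1 \<and> \<alpha> *\<^sub>R (xA, yA) + \<beta> *\<^sub>R (xB, yB) + \<gamma> *\<^sub>R (xC, yB) = p"
  have "convex hull {(xA, yA), (xB, yB), (xC, yB)} =
    {(x, y). \<exists>\<alpha> \<beta> \<gamma>. 0 \<le> \<alpha> \<and> 0 \<le> \<beta> \<and> 0 \<le> \<gamma> \<and> ?P \<alpha> \<beta> \<gamma> (x, y)}"
    unfolding convex_hull_3 by (simp add: set_eq_iff) metis
  also have "\<dots> = {(x, y). let \<theta> = (y - yA) / (yB - yA) in \<theta> \<le> 1 \<and>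
      xA + \<theta> * (xB - xA) \<le> x \<and> x \<le> xA + \<theta> * (xC - xA)}"
    unfolding barycentric_horizontal_base[OF assms] Let_def
    using assms by (auto simp: zero_le_divide_iff)
  finally show ?thesis .
qed

text \<open>
  Area times the value at the centroid, obtained by Fubini from the horizontal slices. The
  apex may lie above or below the base.
\<close>

lemma has_integral_affine_triangle:
  fixes xA yA xB xC yB :: real
  assumes AB: "yA \<noteq> yB" and BC: "xB < xC"
  shows "((\<lambda>p. a + b * fst p + c * snd p) has_integral
      \<bar>yB - yA\<bar> * (xC - xB) / 2 * (a + b * (xA + xB + xC) / 3 + c * (yA + 2 * yB) / 3))
    (convex hull {(xA, yA), (xB, yB), (xC, yB)})"
proof -
  define T where "T = convex hull {(xA, yA), (xB, yB), (xC, yB)}"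
  define f where "f = (\<lambda>p::real \<times> real. a + b * fst p + c * snd p)"
  define D where "D = yB - yA"
  define \<theta> where "\<theta> = (\<lambda>y. (y - yA) / D)"
  define lo hi where "lo = min yA yB" and "hi = max yA yB"
  have D: "D \<noteq> 0" using AB by (simp add: D_def)
  have th: "y \<in> {lo..hi} \<longleftrightarrow> 0 \<le> \<theta> y \<and> \<theta> y \<le> 1" for y
    using AB by (auto simp: \<theta>_def D_def lo_def hi_def divide_simps)
  have T_iff: "(x, y) \<in> T \<longleftrightarrow> \<theta> y \<le> 1 \<and> xA + \<theta> y * (xB - xA) \<le> x \<and> x \<le> xA + \<theta> y * (xC - xA)" for x y
    unfolding T_def triangle_horizontal_base[OF assms] by (simp add: Let_def \<theta>_def D_def)
  have "compact T" unfolding T_def by (intro compact_convex_hull finite_imp_compact) auto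
  then have int: "integrable lborel (\<lambda>p. indicator T p *\<^sub>R f p)"
    unfolding f_def by (intro borel_integrable_compact continuous_intros)
  have slice: "(\<integral>x. indicator T (x, y) *\<^sub>R f (x, y) \<partial>lborel) =
      (\<theta> y * (xC - xB) * (a + c * y + b * (xA + \<theta> y * ((xB + xC) / 2 - xA)))) * indicator {lo..hi} y" for y
  proof (cases "y \<in> {lo..hi}")
    case True
    let ?l = "xA + \<theta> y * (xB - xA)" and ?r = "xA + \<theta> y * (xC - xA)"
    let ?F = "\<lambda>x. (a + c * y) * x + b * x\<^sup>2 / 2"
    have "0 \<le> \<theta> y" "\<theta> y \<le> 1" using True th by auto
    then have lr: "?l \<le> ?r" using BC by (simp add: mult_left_mono)
    have "(\<integral>x. indicator T (x, y) *\<^sub>R f (x, y) \<partial>lborel) =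
        (\<integral>x. (a + b * x + c * y) * indicator {?l..?r} x \<partial>lborel)"
      using \<open>\<theta> y \<le> 1\<close> by (intro Bochner_Integration.integral_cong refl) (auto simp: indicator_def T_iff f_def)
    also have "\<dots> = ?F ?r - ?F ?l"
      by (rule integral_FTC_Icc_real[OF lr])
        (auto intro!: derivative_eq_intros continuous_intros simp: algebra_simps)
    also have "\<dots> = (?r - ?l) * (a + c * y + b * ((?l + ?r) / 2))"
    proof -
      have "((a + c * y) * r + b * r\<^sup>2 / 2) - ((a + c * y) * l + b * l\<^sup>2 / 2) =
          (r - l) * (a + c * y + b * ((l + r) / 2))" for l r
        by (simp add: power2_eq_square field_simps)
      then show ?thesis .
    qed
    also have "?r - ?l = \<theta> y * (xC - xB)" by (simp add: algebra_simps)
    also have "(?l + ?r) / 2 = xA + \<theta> y * ((xB + xC) / 2 - xA)"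
      by (simp add: field_simps)
    finally show ?thesis using True by simp
  next
    case False
    have "(x, y) \<notin> T" for x
    proof
      assume "(x, y) \<in> T"
      then have le: "\<theta> y \<le> 1" "\<theta> y * (xB - xA) \<le> \<theta> y * (xC - xA)"
        unfolding T_iff by linarith+
      then have "\<theta> y < 0" using False th by force
      then have "\<theta> y * (xC - xB) < 0" using BC by (simp add: mult_neg_pos)
      with le show False by (simp add: right_diff_distrib)
    qed
    then show ?thesis using False by simp
  qed
  define E where "E = a + c * yA + b * xA"
  define F where "F = c * D + b * ((xB + xC) / 2 - xA)"
  let ?G = "\<lambda>y. D * (xC - xB) * (E * (\<theta> y)\<^sup>2 / 2 + F * (\<theta> y) ^ 3 / 3)"
  have y: "y = yA + \<theta> y * D" for y using D by (simp add: \<theta>_def)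
  have E: "a + c * y + b * (xA + \<theta> y * ((xB + xC) / 2 - xA)) = E + \<theta> y * F" for y
    using arg_cong[OF y[of y], of "\<lambda>y. c * y"] by (simp add: E_def F_def algebra_simps)
  have dth: "(\<theta> has_real_derivative 1 / D) (at y)" for y
    unfolding \<theta>_def using D by (auto intro!: derivative_eq_intros)
  have cth: "isCont \<theta> y" for y by (rule DERIV_isCont[OF dth])
  have "(\<integral>y. (\<integral>x. indicator T (x, y) *\<^sub>R f (x, y) \<partial>lborel) \<partial>lborel) = ?G hi - ?G lo"
    unfolding slice E
  proof (rule integral_FTC_Icc_real)
    fix y
    have p2: "((\<lambda>y. (\<theta> y)\<^sup>2) has_real_derivative 2 * \<theta> y * (1 / D)) (at y)"
      by (auto intro!: derivative_eq_intros dth)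
    have p3: "((\<lambda>y. (\<theta> y) ^ 3) has_real_derivative 3 * (\<theta> y)\<^sup>2 * (1 / D)) (at y)"
      by (auto intro!: derivative_eq_intros dth)
    have "(?G has_real_derivative D * (xC - xB) *
        (E * (2 * \<theta> y * (1 / D)) / 2 + F * (3 * (\<theta> y)\<^sup>2 * (1 / D)) / 3)) (at y)"
      by (rule DERIV_cmult[OF DERIV_add[OF DERIV_cdivide[OF DERIV_cmult[OF p2]]
            DERIV_cdivide[OF DERIV_cmult[OF p3]]]])
    also have "D * (xC - xB) * (E * (2 * \<theta> y * (1 / D)) / 2 + F * (3 * (\<theta> y)\<^sup>2 * (1 / D)) / 3) =
        \<theta> y * (xC - xB) * (E + \<theta> y * F)"
      using D by (simp add: power2_eq_square field_simps)
    finally show "(?G has_real_derivative \<theta> y * (xC - xB) * (E + \<theta> y * F)) (at y)" .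
    show "isCont (\<lambda>y. \<theta> y * (xC - xB) * (E + \<theta> y * F)) y"
      by (intro continuous_intros cth)
  qed (simp add: lo_def hi_def)
  also have "\<dots> = \<bar>D\<bar> * (xC - xB) * (E / 2 + F / 3)"
  proof -
    have lo: "lo = (if D > 0 then yA else yB)" and hi: "hi = (if D > 0 then yB else yA)"
      by (auto simp: lo_def hi_def D_def)
    have "\<theta> yA = 0" "\<theta> yB = 1" using D by (auto simp: \<theta>_def D_def)
    then show ?thesis
      using D by (cases "D > 0") (simp_all add: lo hi)
  qed
  also have "\<dots> = \<bar>yB - yA\<bar> * (xC - xB) / 2 * (a + b * (xA + xB + xC) / 3 + c * (yA + 2 * yB) / 3)"
    by (simp add: D_def E_def F_def algebra_simps add_divide_distrib diff_divide_distrib)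
  also have "(\<integral>y. (\<integral>x. indicator T (x, y) *\<^sub>R f (x, y) \<partial>lborel) \<partial>lborel) =
      integral\<^sup>L lborel (\<lambda>p. indicator T p *\<^sub>R f p)"
    using lborel_pair.integral_snd[of "\<lambda>x y. indicator T (x, y) *\<^sub>R f (x, y)"] int
    by (simp add: lborel_prod case_prod_beta')
  finally have I: "integral\<^sup>L lborel (\<lambda>p. indicator T p *\<^sub>R f p) =
      \<bar>yB - yA\<bar> * (xC - xB) / 2 * (a + b * (xA + xB + xC) / 3 + c * (yA + 2 * yB) / 3)" .
  have "(\<lambda>p. indicator T p *\<^sub>R f p) = (\<lambda>p. if p \<in> T then f p else 0)" by auto
  with has_integral_integral_lborel[OF int, unfolded I] show ?thesis
    unfolding T_def[symmetric] f_def[symmetric] by (simp only: has_integral_restrict_UNIV)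
qed

section \<open>The triangles of the mesh\<close>

locale mesh =
  fixes n m :: nat
  assumes n_pos: "1 \<le> n" and n_le_m: "n \<le> m"
begin

definition gx :: "nat \<Rightarrow> real" where "gx i = real i / (2 * real n)"
definition hy :: "nat \<Rightarrow> real" where "hy j = real j / (2 * real m)"
text \<open>
  In row \<open>k\<close> the triangles are numbered from left to right by the abscissa \<open>i/(2n)\<close> of the apex, and they
  point alternately up and down. A vertex \<open>(i/(2n), j/(2m))\<close> with \<open>0 < i < 2n\<close> has \<open>i\<close> and \<open>j\<close> of the same
  parity, which determines the ordinate of the apex.
\<close>

definition y_apex :: "nat \<Rightarrow> nat \<Rightarrow> real" where
  "y_apex k i = hy (if even (i + k) then k else k + 1)"
definition y_base :: "nat \<Rightarrow> nat \<Rightarrow> real" where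
  "y_base k i = hy (if even (i + k) then k + 1 else k)"
text \<open>
  The truncated difference for \<open>i = 0\<close>, and the minimum for \<open>i = 2n\<close>, make the first and the last triangle of a
  row the right-angled halves that have a side on \<open>x = 0\<close> or \<open>x = 1\<close>.
\<close>

definition x_left :: "nat \<Rightarrow> real" where "x_left i = gx (i - 1)"
definition x_right :: "nat \<Rightarrow> real" where "x_right i = gx (min (i + 1) (2 * n))"
definition tri :: "nat \<Rightarrow> nat \<Rightarrow> (real \<times> real) set" where
  "tri k i = convex hull {(gx i, y_apex k i), (x_left i, y_base k i), (x_right i, y_base k i)}"

lemma m_pos: "1 \<le> m" using n_pos n_le_m by simp

lemma y_apex_neq_base: "y_apex k i \<noteq> y_base k i"
  using m_pos by (simp add: y_apex_def y_base_def hy_def)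

lemma x_left_less_right: "i \<le> 2 * n \<Longrightarrow> x_left i < x_right i"
proof -
  assume "i \<le> 2 * n"
  then have "real (i - 1) < real (min (i + 1) (2 * n))" using n_pos by auto
  then show ?thesis
    unfolding x_left_def x_right_def gx_def using n_pos by (intro divide_strict_right_mono) auto
qed

lemma gx_minus_left: "gx i - x_left i = of_bool (i > 0) / (2 * real n)"
  by (cases i) (simp_all add: gx_def x_left_def add_divide_distrib)

lemma right_minus_gx: "i \<le> 2 * n \<Longrightarrow> x_right i - gx i = of_bool (i < 2 * n) / (2 * real n)"
  using n_pos by (auto simp: gx_def x_right_def min_def field_simps)

text \<open>
  The signed distance from the apex towards the base, in units of the height of a row.
\<close>

definition level :: "nat \<Rightarrow> nat \<Rightarrow> real \<Rightarrow> real" where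
  "level k i y = (if even (i + k) then 2 * real m * y - real k else real k + 1 - 2 * real m * y)"

lemma level_eq: "level k i y = (y - y_apex k i) / (y_base k i - y_apex k i)"
  using m_pos by (auto simp: level_def y_apex_def y_base_def hy_def field_simps)

text \<open>
  In the coordinates \<open>s = 2 m y\<close> and \<open>t = 2 n x\<close> the mesh lines are \<open>s = j\<close> and \<open>s \<plusminus> t = 2 j\<close>, and
  every triangle is the standard one, cut off by the square in the first and last place of a row.
\<close>

lemma mem_interior_tri:
  assumes i: "i \<le> 2 * n"
  shows "(x, y) \<in> interior (tri k i) \<longleftrightarrow>
    \<bar>2 * real n * x - real i\<bar> < level k i y \<and> level k i y < 1 \<and> 0 < x \<and> x < 1"
proof -
  define \<theta> where "\<theta> = level k i y"
  define t where "t = 2 * real n * x"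
  have np: "real n \<ge> 1" using n_pos by simp
  have xl: "x_left i = (real i - of_bool (i > 0)) / (2 * real n)"
    using gx_minus_left[of i] by (simp add: gx_def diff_divide_distrib)
  have xr: "x_right i = (real i + of_bool (i < 2 * n)) / (2 * real n)"
    using right_minus_gx[OF i] by (simp add: gx_def add_divide_distrib)
  have "(x, y) \<in> interior (tri k i) \<longleftrightarrow>
      \<theta> < 1 \<and> gx i + \<theta> * (x_left i - gx i) < x \<and> x < gx i + \<theta> * (x_right i - gx i)"
    unfolding tri_def interior_triangle_horizontal_base[OF y_apex_neq_base x_left_less_right[OF i]]
    by (simp add: Let_def \<theta>_def level_eq)
  also have "gx i + \<theta> * (x_left i - gx i) < x \<longleftrightarrow> real i - \<theta> * of_bool (i > 0) < t"
    using np by (simp add: xl gx_def t_def field_simps)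
  also have "x < gx i + \<theta> * (x_right i - gx i) \<longleftrightarrow> t < real i + \<theta> * of_bool (i < 2 * n)"
    using np by (simp add: xr gx_def t_def field_simps)
  also have "\<theta> < 1 \<and> real i - \<theta> * of_bool (i > 0) < t \<and> t < real i + \<theta> * of_bool (i < 2 * n) \<longleftrightarrow>
      \<bar>t - real i\<bar> < \<theta> \<and> \<theta> < 1 \<and> 0 < t \<and> t < 2 * real n"
  proof -
    consider "i = 0" | "0 < i" "i < 2 * n" | "i = 2 * n" using i by linarith
    then show ?thesis
    proof cases
      case 1
      then show ?thesis using np by auto
    next
      case 2
      then have "1 \<le> real i" "real i + 1 \<le> 2 * real n" by linarith+
      with 2 show ?thesis by auto
    next
      case 3
      then show ?thesis using np by auto
    qed
  qed
  also have "0 < t \<longleftrightarrow> 0 < x" using np by (simp add: t_def zero_less_mult_iff)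
  also have "t < 2 * real n \<longleftrightarrow> x < 1" using np by (simp add: t_def)
  finally show ?thesis by (simp add: \<theta>_def t_def)
qed

lemma interior_tri_nonempty:
  assumes i: "i \<le> 2 * n"
  shows "interior (tri k i) \<noteq> {}"
  unfolding tri_def
proof (subst interior_triangle_horizontal_base[OF y_apex_neq_base x_left_less_right[OF i]])
  let ?D = "y_base k i - y_apex k i"
  have half: "(y_apex k i + ?D / 2 - y_apex k i) / ?D = 1 / 2"
    using y_apex_neq_base[of k i] by simp
  have "(gx i + ((x_left i + x_right i) / 2 - gx i) / 2, y_apex k i + ?D / 2) \<in>
     {(x, y). let \<theta> = (y - y_apex k i) / ?D in \<theta> < 1 \<and>
       gx i + \<theta> * (x_left i - gx i) < x \<and> x < gx i + \<theta> * (x_right i - gx i)}"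
    unfolding mem_Collect_eq prod.case Let_def half using x_left_less_right[OF i] by simp
  then show "{(x, y). let \<theta> = (y - y_apex k i) / ?D in \<theta> < 1 \<and>
       gx i + \<theta> * (x_left i - gx i) < x \<and> x < gx i + \<theta> * (x_right i - gx i)} \<noteq> {}" by blast
qed

lemma closure_interior_tri: "i \<le> 2 * n \<Longrightarrow> closure (interior (tri k i)) = tri k i"
  using convex_closure_interior[of "tri k i"] interior_tri_nonempty[of i k]
  by (simp add: tri_def compact_imp_closed compact_convex_hull finite_imp_compact)

lemma interior_tri_unique:
  assumes "p \<in> interior (tri k i)" "p \<in> interior (tri k' i')" "i \<le> 2 * n" "i' \<le> 2 * n"
  shows "k = k' \<and> i = i'"
proof -
  obtain x y where p: "p = (x, y)" by (cases p)
  define s t where "s = 2 * real m * y" and "t = 2 * real n * x"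
  have 1: "\<bar>t - real i\<bar> < level k i y" "level k i y < 1"
    and 2: "\<bar>t - real i'\<bar> < level k' i' y" "level k' i' y < 1"
    using assms mem_interior_tri by (auto simp: p t_def)
  have "real k < s" "s < real k + 1" "real k' < s" "s < real k' + 1"
    using 1 2 by (auto simp: level_def s_def split: if_splits)
  then have k: "k' = k" by linarith
  have "i' = i"
  proof (cases "even i = even i'")
    case True
    have "\<bar>int i - int i'\<bar> < 2" using 1 2 by linarith
    with True show ?thesis by presburger
  next
    case False
    then have "level k' i' y = 1 - level k i y"
      by (auto simp: level_def k)
    then have "\<bar>real i - real i'\<bar> < 1" using 1 2 by linarith
    then show ?thesis by linarith
  qed
  with k show ?thesis by simp
qed

lemma interior_unit_square: "interior unit_square = {0<..<1} \<times> {0<..<1}"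
  by (simp add: unit_square_def interior_Times)

text \<open>
  Because \<open>n \<le> m\<close>, the finite ranges of \<open>j\<close> contain every line of the three systems that meets the open square.
\<close>

lemma mem_mesh_lines:
  assumes x: "0 < x" "x < 1" and y: "0 < y" "y < 1"
  defines "s \<equiv> 2 * real m * y" and "t \<equiv> 2 * real n * x"
  shows "(x, y) \<in> \<Union> (mesh_lines n m) \<longleftrightarrow>
    (\<exists>j. s = of_int j) \<or> (\<exists>j. s - t = 2 * of_int j) \<or> (\<exists>j. s + t = 2 * of_int j)"
proof -
  have np: "real n \<ge> 1" "real m \<ge> real n" using n_pos n_le_m by auto
  have s: "0 < s" "s < 2 * real m" using y np by (auto simp: s_def)
  have t: "0 < t" "t < 2 * real n" using x np by (auto simp: t_def)
  have 1: "y = real_of_int j / (2 * real m) \<longleftrightarrow> s = of_int j" for j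
    using np by (auto simp: s_def field_simps)
  have 2: "y = real n / real m * x + real_of_int j / real m \<longleftrightarrow> s - t = 2 * of_int j" for j
    using np by (auto simp: s_def t_def field_simps)
  have 3: "y = - (real n / real m) * x + real_of_int j / real m \<longleftrightarrow> s + t = 2 * of_int j" for j
    using np by (auto simp: s_def t_def field_simps)
  have r1: "j \<in> {1..2 * int m - 1}" if "s = of_int j" for j using that s by auto
  have r2: "j \<in> {1 - int m..int m - 1}" if "s - t = 2 * of_int j" for j
  proof -
    have "- real m < of_int j" "of_int j < real m" using that s t np by linarith+
    then show ?thesis by auto
  qed
  have r3: "j \<in> {1..2 * int m - 1}" if "s + t = 2 * of_int j" for j
  proof -
    have "0 < real_of_int j" "of_int j < 2 * real m" using that s t np by linarith+
    then show ?thesis by auto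
  qed
  have "(x, y) \<in> \<Union> (mesh_lines n m) \<longleftrightarrow>
     (\<exists>j\<in>{1..2 * int m - 1}. y = real_of_int j / (2 * real m)) \<or>
     (\<exists>j\<in>{1 - int m..int m - 1}. y = real n / real m * x + real_of_int j / real m) \<or>
     (\<exists>j\<in>{1..2 * int m - 1}. y = - (real n / real m) * x + real_of_int j / real m)"
    unfolding mesh_lines_def by blast
  also have "\<dots> \<longleftrightarrow> (\<exists>j. s = of_int j) \<or> (\<exists>j. s - t = 2 * of_int j) \<or> (\<exists>j. s + t = 2 * of_int j)"
    unfolding 1 2 3 using r1 r2 r3 by blast
  finally show ?thesis .
qed

text \<open>
  Given a point off the lines, let \<open>k\<close> and \<open>r\<close> be the integer parts of \<open>s\<close> and \<open>t\<close>. The unit square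
  at \<open>(r, k)\<close> is cut by exactly one diagonal; which one depends on the parity of \<open>r + k\<close>. The point lies in
  triangle \<open>r\<close> or in triangle \<open>r + 1\<close> according to its side of that diagonal.
\<close>

lemma square_minus_lines:
  "interior unit_square - \<Union> (mesh_lines n m) = (\<Union>k<2 * m. \<Union>i\<le>2 * n. interior (tri k i))"
proof (intro equalityI subsetI)
  fix p assume p: "p \<in> interior unit_square - \<Union> (mesh_lines n m)"
  obtain x y where p_eq: "p = (x, y)" by (cases p)
  define s t where "s = 2 * real m * y" and "t = 2 * real n * x"
  have np: "real n \<ge> 1" "real m \<ge> 1" using n_pos m_pos by auto
  have xy: "0 < x" "x < 1" "0 < y" "y < 1" using p by (auto simp: p_eq interior_unit_square)
  have no: "s \<noteq> of_int j" "s - t \<noteq> 2 * of_int j" "s + t \<noteq> 2 * of_int j" for j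
    using p mem_mesh_lines[OF xy] by (auto simp: p_eq s_def t_def)
  have s: "0 < s" "s < 2 * real m" using xy np by (auto simp: s_def)
  have t: "0 < t" "t < 2 * real n" using xy np by (auto simp: t_def)
  define k where "k = nat \<lfloor>s\<rfloor>"
  have k: "real k \<le> s" "s < real k + 1" using s by (auto simp: k_def)
  have "s \<noteq> real k" using no(1)[of "int k"] by simp
  with k have k: "real k < s" "s < real k + 1" by auto
  have k_less: "k < 2 * m" using k s by linarith
  define r where "r = nat \<lfloor>t\<rfloor>"
  have r: "real r \<le> t" "t < real r + 1" using t by (auto simp: r_def)
  have r_less: "r < 2 * n" using r t by linarith
  have "\<exists>i\<le>2 * n. \<bar>t - real i\<bar> < level k i y \<and> level k i y < 1"
  proof (cases "even (r + k)")
    case True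
    then have "t - real r \<noteq> s - real k"
    proof -
      have "even (int k - int r)" using True by simp
      then obtain j where "int k - int r = 2 * j" by (elim evenE)
      then have "real_of_int (int k - int r) = real_of_int (2 * j)" by (simp only:)
      then have "real k - real r = 2 * of_int j" by simp
      with no(2)[of j] show ?thesis by linarith
    qed
    then consider "t - real r < s - real k" | "t - real r > s - real k" by linarith
    then show ?thesis
    proof cases
      case 1
      then show ?thesis
        using True r k r_less by (intro exI[of _ r]) (auto simp: level_def s_def[symmetric])
    next
      case 2
      then show ?thesis
        using True r k r_less by (intro exI[of _ "r + 1"]) (auto simp: level_def s_def[symmetric])
    qed
  next
    case False
    then have "t - real r \<noteq> real k + 1 - s"
    proof -
      have "even (int k + int r + 1)" using False by simp
      then obtain j where "int k + int r + 1 = 2 * j" by (elim evenE)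
      then have "real_of_int (int k + int r + 1) = real_of_int (2 * j)" by (simp only:)
      then have "real k + real r + 1 = 2 * of_int j" by simp
      with no(3)[of j] show ?thesis by linarith
    qed
    then consider "t - real r < real k + 1 - s" | "t - real r > real k + 1 - s" by linarith
    then show ?thesis
    proof cases
      case 1
      then show ?thesis
        using False r k r_less by (intro exI[of _ r]) (auto simp: level_def s_def[symmetric])
    next
      case 2
      then show ?thesis
        using False r k r_less by (intro exI[of _ "r + 1"]) (auto simp: level_def s_def[symmetric])
    qed
  qed
  then obtain i where "i \<le> 2 * n" "\<bar>t - real i\<bar> < level k i y" "level k i y < 1" by blast
  then have "p \<in> interior (tri k i)"
    using xy by (simp add: p_eq mem_interior_tri t_def)
  with \<open>i \<le> 2 * n\<close> k_less show "p \<in> (\<Union>k<2 * m. \<Union>i\<le>2 * n. interior (tri k i))" by blast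
next
  fix p assume "p \<in> (\<Union>k<2 * m. \<Union>i\<le>2 * n. interior (tri k i))"
  then obtain k i where ki: "k < 2 * m" "i \<le> 2 * n" "p \<in> interior (tri k i)" by blast
  obtain x y where p_eq: "p = (x, y)" by (cases p)
  define s t where "s = 2 * real m * y" and "t = 2 * real n * x"
  have np: "real n \<ge> 1" "real m \<ge> 1" using n_pos m_pos by auto
  have t: "\<bar>t - real i\<bar> < level k i y" "level k i y < 1" and x: "0 < x" "x < 1"
    using ki(3) by (auto simp: p_eq mem_interior_tri[OF ki(2)] t_def)
  have s: "real k < s" "s < real k + 1"
    using t by (auto simp: level_def s_def split: if_splits)
  have "0 < s" "s < 2 * real m" using s ki(1) by linarith+
  then have y: "0 < y" "y < 1" using np by (auto simp: s_def zero_less_mult_iff)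
  have n1: "s \<noteq> of_int j" for j
  proof
    assume "s = of_int j"
    then have "int k < j" "j < int k + 1" using s by linarith+
    then show False by linarith
  qed
  have n2: "s - t \<noteq> 2 * of_int j" for j
  proof
    assume st: "s - t = 2 * of_int j"
    show False
    proof (cases "even (i + k)")
      case True
      then have "real_of_int (2 * j) > real_of_int (int k - int i)" "real_of_int (2 * j) < real_of_int (int k - int i) + 2"
        using t s st by (auto simp: level_def s_def[symmetric])
      then have "2 * j = int k - int i + 1" by linarith
      with True show False by presburger
    next
      case False
      then have "real_of_int (2 * j) > real_of_int (int k - int i) - 1" "real_of_int (2 * j) < real_of_int (int k - int i) + 1"
        using t s st by (auto simp: level_def s_def[symmetric])
      then have "2 * j = int k - int i" by linarith
      with False show False by presburger
    qed
  qed
  have n3: "s + t \<noteq> 2 * of_int j" for j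
  proof
    assume st: "s + t = 2 * of_int j"
    show False
    proof (cases "even (i + k)")
      case True
      then have "real_of_int (2 * j) > real_of_int (int k + int i)" "real_of_int (2 * j) < real_of_int (int k + int i) + 2"
        using t s st by (auto simp: level_def s_def[symmetric])
      then have "2 * j = int k + int i + 1" by linarith
      with True show False by presburger
    next
      case False
      then have "real_of_int (2 * j) > real_of_int (int k + int i) - 1" "real_of_int (2 * j) < real_of_int (int k + int i) + 1"
        using t s st by (auto simp: level_def s_def[symmetric])
      then have "2 * j = int k + int i" by linarith
      with False show False by presburger
    qed
  qed
  have "p \<notin> \<Union> (mesh_lines n m)"
    unfolding p_eq mem_mesh_lines[OF x y] using n1 n2 n3 by (simp add: s_def t_def)
  then show "p \<in> interior unit_square - \<Union> (mesh_lines n m)"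
    using x y by (simp add: p_eq interior_unit_square)
qed

lemma triangulation_eq: "triangulation n m = (\<lambda>(k, i). tri k i) ` ({..<2 * m} \<times> {..2 * n})"
proof -
  let ?I = "{..<2 * m} \<times> {..2 * n}"
  let ?C = "(\<lambda>(k, i). interior (tri k i)) ` ?I"
  let ?D = "{interior (tri k i) | k i. k < 2 * m \<and> i \<le> 2 * n}"
  have "interior unit_square - \<Union> (mesh_lines n m) = \<Union> ?C"
    unfolding square_minus_lines by auto
  moreover have C: "?C = {interior (tri k i) | k i. k < 2 * m \<and> i \<le> 2 * n}"
    by auto
  moreover have "components (\<Union> ?C) = ?C"
    unfolding C
  proof (rule components_of_open_connected_partition)
    show "connected C" if "C \<in> ?D" for C
    proof -
      from that obtain k i where "C = interior (tri k i)" by blast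
      then show ?thesis
        unfolding tri_def by (metis convex_connected convex_interior convex_convex_hull)
    qed
    show "{} \<notin> ?D"
    proof
      assume "{} \<in> ?D"
      then obtain k i where "i \<le> 2 * n" "interior (tri k i) = {}" by blast
      with interior_tri_nonempty show False by blast
    qed
    show "disjoint ?D"
    proof (rule disjointI)
      fix C D assume "C \<in> ?D" "D \<in> ?D" "C \<noteq> D"
      then obtain k i k' i' where ki: "i \<le> 2 * n" "C = interior (tri k i)"
          "i' \<le> 2 * n" "D = interior (tri k' i')"
        by blast
      show "C \<inter> D = {}"
      proof (rule equals0I)
        fix p assume "p \<in> C \<inter> D"
        then have "k = k' \<and> i = i'" using interior_tri_unique ki by blast
        with ki \<open>C \<noteq> D\<close> show False by blast
      qed
    qed
  qed auto
  moreover have "closure ` ?C = (\<lambda>(k, i). tri k i) ` ?I"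
    unfolding image_image by (intro image_cong refl) (auto simp: closure_interior_tri)
  ultimately show ?thesis unfolding triangulation_def by simp
qed

lemma inj_on_tri: "inj_on (\<lambda>(k, i). tri k i) ({..<2 * m} \<times> {..2 * n})"
proof (rule inj_onI, clarsimp)
  fix k i k' i' assume *: "tri k i = tri k' i'" "i \<le> 2 * n" "i' \<le> 2 * n"
  obtain p where "p \<in> interior (tri k i)" using interior_tri_nonempty[OF *(2)] by blast
  moreover have "p \<in> interior (tri k' i')" using calculation unfolding *(1) .
  ultimately show "k = k' \<and> i = i'" using interior_tri_unique *(2,3) by blast
qed

lemma sum_triangulation:
  "(\<Sum>T\<in>triangulation n m. f T) = (\<Sum>k<2 * m. \<Sum>i\<le>2 * n. f (tri k i))"
  unfolding triangulation_eq sum.reindex[OF inj_on_tri]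
  by (simp add: sum.cartesian_product case_prod_beta')

end

section \<open>The nonconforming interpolant\<close>

lemma nonconforming_P1_diff:
  assumes "v \<in> nonconforming_P1 n m" "w \<in> nonconforming_P1 n m"
  shows "(\<lambda>T p. v T p - w T p) \<in> nonconforming_P1 n m"
proof -
  have v: "\<forall>T\<in>triangulation n m. linear_poly_on T (v T)" "continuous_at_interior_midpoints n m v"
      "vanishes_at_lateral_midpoints n m v" "periodic_at_midpoints n m v"
    and w: "\<forall>T\<in>triangulation n m. linear_poly_on T (w T)" "continuous_at_interior_midpoints n m w"
      "vanishes_at_lateral_midpoints n m w" "periodic_at_midpoints n m w"
    using assms unfolding nonconforming_P1_def by blast+
  have "linear_poly_on T (\<lambda>p. v T p - w T p)" if T: "T \<in> triangulation n m" for T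
  proof -
    have "linear_poly_on T (v T)" "linear_poly_on T (w T)" using v(1) w(1) T by blast+
    then obtain a b c a' b' c' where vw:
      "\<forall>(x, y)\<in>T. v T (x, y) = a + b * x + c * y" "\<forall>(x, y)\<in>T. w T (x, y) = a' + b' * x + c' * y"
      unfolding linear_poly_on_def by blast
    have "v T (x, y) - w T (x, y) = (a - a') + (b - b') * x + (c - c') * y"
      if "(x, y) \<in> T" for x y
      using bspec[OF vw(1) that] bspec[OF vw(2) that] by (simp add: left_diff_distrib)
    then have "\<forall>(x, y)\<in>T. v T (x, y) - w T (x, y) = (a - a') + (b - b') * x + (c - c') * y"
      by blast
    then show ?thesis unfolding linear_poly_on_def by blast
  qed
  moreover have "continuous_at_interior_midpoints n m (\<lambda>T p. v T p - w T p)"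
    unfolding continuous_at_interior_midpoints_def
  proof (intro ballI allI impI)
    fix T T' a b
    assume *: "T \<in> triangulation n m" "T' \<in> triangulation n m" "closed_segment a b edge_of T"
      "closed_segment a b edge_of T'" "\<not> closed_segment a b \<subseteq> frontier unit_square"
    have "v T (midpoint a b) = v T' (midpoint a b)" "w T (midpoint a b) = w T' (midpoint a b)"
      using * v(2) w(2) unfolding continuous_at_interior_midpoints_def by blast+
    then show "v T (midpoint a b) - w T (midpoint a b) = v T' (midpoint a b) - w T' (midpoint a b)"
      by (simp only:)
  qed
  moreover have "vanishes_at_lateral_midpoints n m (\<lambda>T p. v T p - w T p)"
    using v(3) w(3) by (simp add: vanishes_at_lateral_midpoints_def)
  moreover have "periodic_at_midpoints n m (\<lambda>T p. v T p - w T p)"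
    unfolding periodic_at_midpoints_def
  proof (intro ballI allI impI)
    fix T T' and x x' :: real
    assume *: "T \<in> triangulation n m" "T' \<in> triangulation n m"
      "closed_segment (x, 0) (x', 0) edge_of T" "closed_segment (x, 1) (x', 1) edge_of T'"
    have "v T (midpoint (x, 0) (x', 0)) = v T' (midpoint (x, 1) (x', 1))"
        "w T (midpoint (x, 0) (x', 0)) = w T' (midpoint (x, 1) (x', 1))"
      using * v(4) w(4) unfolding periodic_at_midpoints_def by blast+
    then show "v T (midpoint (x, 0) (x', 0)) - w T (midpoint (x, 0) (x', 0)) =
        v T' (midpoint (x, 1) (x', 1)) - w T' (midpoint (x, 1) (x', 1))"
      by (simp only:)
  qed
  ultimately show ?thesis unfolding nonconforming_P1_def by blast
qed

text \<open>
  The mean of \<open>x (1 - x) / 2\<close> over the interval between \<open>p\<close> and \<open>q\<close>.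
\<close>

definition parabola_edge_mean :: "real \<Rightarrow> real \<Rightarrow> real" where
  "parabola_edge_mean p q = (p + q) / 4 - (p\<^sup>2 + p * q + q\<^sup>2) / 6"

text \<open>
  The affine function \<open>x / 2 + (p q + q r + r p) / 6 - (p + q + r) x / 3\<close> is symmetric in \<open>p\<close>, \<open>q\<close>, \<open>r\<close>. So the same
  function attains the means over all three edges of a triangle whose vertices have these abscissae.
\<close>

lemma affine_through_edge_means:
  "(p + q) / 2 / 2 + (p * q + q * r + r * p) / 6 - (p + q + r) / 3 * ((p + q) / 2) =
    parabola_edge_mean p q"
  by (simp add: parabola_edge_mean_def power2_eq_square field_simps)

context mesh
begin

definition x_centroid :: "nat \<Rightarrow> real" where "x_centroid i = (gx i + x_left i + x_right i) / 3"
definition area :: "nat \<Rightarrow> real" where "area i = (x_right i - x_left i) / (4 * real m)"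

lemma tri_in_triangulation: "k < 2 * m \<Longrightarrow> i \<le> 2 * n \<Longrightarrow> tri k i \<in> triangulation n m"
  by (auto simp: triangulation_eq)

lemma edge_of_tri_iff:
  assumes "i \<le> 2 * n"
  shows "closed_segment a b edge_of tri k i \<longleftrightarrow>
    {a, b} = {(gx i, y_apex k i), (x_left i, y_base k i)} \<or>
    {a, b} = {(gx i, y_apex k i), (x_right i, y_base k i)} \<or>
    {a, b} = {(x_left i, y_base k i), (x_right i, y_base k i)}"
  unfolding tri_def
  by (rule closed_segment_edge_of_triangle_iff[OF
        not_collinear_horizontal_base[OF y_apex_neq_base x_left_less_right[OF assms]]])

text \<open>
  A broken function is indexed by the triangles as sets, so the interpolant has to recover the number of a
  triangle from the set. The row does not matter, because \<open>u\<close> depends on \<open>x\<close> alone.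
\<close>

definition column :: "(real \<times> real) set \<Rightarrow> nat" where
  "column T = snd (inv_into ({..<2 * m} \<times> {..2 * n}) (\<lambda>(k, i). tri k i) T)"

lemma column_tri: "k < 2 * m \<Longrightarrow> i \<le> 2 * n \<Longrightarrow> column (tri k i) = i"
  unfolding column_def using inv_into_f_f[OF inj_on_tri, of "(k, i)"] by simp

definition interpolant :: broken_fun where
  "interpolant T p = (let i = column T in
     (gx i * x_left i + x_left i * x_right i + x_right i * gx i) / 6 + (1 / 2 - x_centroid i) * fst p)"

lemma interpolant_at_midpoint:
  assumes T: "T \<in> triangulation n m" and e: "closed_segment a b edge_of T"
  shows "interpolant T (midpoint a b) = parabola_edge_mean (fst a) (fst b)"
proof -
  from T obtain k i where ki: "k < 2 * m" "i \<le> 2 * n" "T = tri k i"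
    by (auto simp: triangulation_eq)
  define K where "K = gx i * x_left i + x_left i * x_right i + x_right i * gx i"
  have val: "interpolant T p = fst p / 2 + K / 6 - x_centroid i * fst p" for p
    using ki by (simp add: interpolant_def column_tri Let_def K_def algebra_simps)
  have main: "interpolant T (midpoint a b) = parabola_edge_mean p q"
    if "fst a = p" "fst b = q" "K = p * q + q * r + r * p" "gx i + x_left i + x_right i = p + q + r" for p q r
  proof -
    have mid: "fst (midpoint a b) = (p + q) / 2"
      using that by (simp add: midpoint_def)
    show ?thesis
      unfolding val mid that(1,2) affine_through_edge_means[of p q r, symmetric] x_centroid_def that(3,4) ..
  qed
  from e ki(2,3) consider
      "a = (gx i, y_apex k i)" "b = (x_left i, y_base k i)"
    | "b = (gx i, y_apex k i)" "a = (x_left i, y_base k i)"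
    | "a = (gx i, y_apex k i)" "b = (x_right i, y_base k i)"
    | "b = (gx i, y_apex k i)" "a = (x_right i, y_base k i)"
    | "a = (x_left i, y_base k i)" "b = (x_right i, y_base k i)"
    | "b = (x_left i, y_base k i)" "a = (x_right i, y_base k i)"
    by (auto simp: edge_of_tri_iff doubleton_eq_iff)
  then show ?thesis
  proof cases
    case 1
    then show ?thesis using main[of "fst a" "fst b" "x_right i"] by (simp add: K_def)
  next
    case 2
    then show ?thesis using main[of "fst a" "fst b" "x_right i"] by (simp add: K_def algebra_simps)
  next
    case 3
    then show ?thesis using main[of "fst a" "fst b" "x_left i"] by (simp add: K_def algebra_simps)
  next
    case 4
    then show ?thesis using main[of "fst a" "fst b" "x_left i"] by (simp add: K_def algebra_simps)
  next
    case 5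
    then show ?thesis using main[of "fst a" "fst b" "gx i"] by (simp add: K_def algebra_simps)
  next
    case 6
    then show ?thesis using main[of "fst a" "fst b" "gx i"] by (simp add: K_def algebra_simps)
  qed
qed

text \<open>
  The midpoint value depends on the edge alone, in fact only on the abscissae of its end points. This gives
  continuity and periodicity, and the value is \<open>0\<close> when both abscissae are \<open>0\<close> or both are \<open>1\<close>.
\<close>

lemma interpolant_in_nonconforming_P1: "interpolant \<in> nonconforming_P1 n m"
  unfolding nonconforming_P1_def mem_Collect_eq
proof (intro conjI ballI)
  fix T
  let ?i = "column T"
  let ?K = "(gx ?i * x_left ?i + x_left ?i * x_right ?i + x_right ?i * gx ?i) / 6"
  have "\<forall>(x, y)\<in>T. interpolant T (x, y) = ?K + (1 / 2 - x_centroid ?i) * x + 0 * y"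
    by (auto simp: interpolant_def Let_def)
  then show "linear_poly_on T (interpolant T)"
    unfolding linear_poly_on_def by blast
next
  show "continuous_at_interior_midpoints n m interpolant"
    by (simp add: continuous_at_interior_midpoints_def interpolant_at_midpoint)
next
  have "fst a = z \<and> fst b = z" if "closed_segment a b \<subseteq> {z} \<times> UNIV" for a b :: "real \<times> real" and z
    using that ends_in_segment[of a b] by auto
  then show "vanishes_at_lateral_midpoints n m interpolant"
    unfolding vanishes_at_lateral_midpoints_def
    by (fastforce simp: interpolant_at_midpoint parabola_edge_mean_def)
next
  show "periodic_at_midpoints n m interpolant"
    by (simp add: periodic_at_midpoints_def interpolant_at_midpoint)
qed

section \<open>Integrals over the triangles\<close>

lemma has_integral_affine_tri:
  assumes i: "i \<le> 2 * n"
  shows "((\<lambda>p. a + b * fst p + c * snd p) has_integral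
    area i * (a + b * x_centroid i + c * (y_apex k i + 2 * y_base k i) / 3)) (tri k i)"
proof -
  have "\<bar>y_base k i - y_apex k i\<bar> = 1 / (2 * real m)"
    using m_pos by (auto simp: y_base_def y_apex_def hy_def field_simps)
  then show ?thesis
    using has_integral_affine_triangle[OF y_apex_neq_base[of k i] x_left_less_right[OF i],
        where xA = "gx i" and a = a and b = b and c = c]
    by (simp add: tri_def area_def x_centroid_def add_ac mult_ac)
qed

lemma negligible_boundary_tri: "negligible (tri k i - interior (tri k i))"
proof -
  have "closed (tri k i)"
    by (simp add: tri_def compact_imp_closed compact_convex_hull finite_imp_compact)
  then have "frontier (tri k i) = tri k i - interior (tri k i)"
    by (simp add: frontier_def)
  moreover have "negligible (frontier (tri k i))"
    by (rule negligible_convex_frontier) (simp add: tri_def)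
  ultimately show ?thesis by simp
qed

lemma integral_const_interior_tri:
  assumes i: "i \<le> 2 * n" and eq: "\<And>p. p \<in> interior (tri k i) \<Longrightarrow> f p = K"
  shows "integral (tri k i) f = area i * K"
proof (rule integral_unique, rule has_integral_spike[OF negligible_boundary_tri[of k i]])
  show "((\<lambda>p. K + 0 * fst p + 0 * snd p) has_integral area i * K) (tri k i)"
    using has_integral_affine_tri[OF i, of K 0 0 k] by simp
qed (simp add: eq)

lemma area_pos: "i \<le> 2 * n \<Longrightarrow> 0 < area i"
  using x_left_less_right m_pos by (simp add: area_def)

text \<open>
  A nonintegrable \<open>f\<close> has integral \<open>0\<close> by convention; this case is why \<open>K\<close> must be nonnegative.
\<close>

lemma integral_bound_interior_tri:
  assumes i: "i \<le> 2 * n" and le: "\<And>p. p \<in> interior (tri k i) \<Longrightarrow> f p \<le> K" and K: "0 \<le> K"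
  shows "integral (tri k i) f \<le> area i * K"
proof (cases "f integrable_on tri k i")
  case True
  let ?g = "\<lambda>p. if p \<in> interior (tri k i) then f p else K"
  have eq: "?g p = f p" if "p \<in> tri k i - (tri k i - interior (tri k i))" for p
    using that by simp
  have g: "?g integrable_on tri k i"
    by (rule integrable_spike[OF True negligible_boundary_tri eq])
  have K': "((\<lambda>p. K) has_integral area i * K) (tri k i)"
    using has_integral_affine_tri[OF i, of K 0 0 k] by simp
  have "integral (tri k i) f = integral (tri k i) ?g"
    by (rule integral_spike[OF negligible_boundary_tri[of k i]]) simp
  also have "\<dots> \<le> integral (tri k i) (\<lambda>p. K)"
    using g K' le by (intro integral_le) auto
  finally show ?thesis using K' by (simp add: integral_unique)
next
  case False
  then show ?thesis using area_pos[OF i] K by (simp add: not_integrable_integral)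
qed

lemma has_derivative_affine_tri:
  assumes f: "\<And>p. p \<in> tri k i \<Longrightarrow> f p = a + b * fst p + c * snd p"
    and p: "p \<in> interior (tri k i)"
  shows "(f has_derivative (\<lambda>h. h \<bullet> (b, c))) (at p)"
proof -
  have "((\<lambda>p. a + b * fst p + c * snd p) has_derivative (\<lambda>h. h \<bullet> (b, c))) (at p)"
    by (auto intro!: derivative_eq_intros simp: inner_prod_def algebra_simps)
  then show ?thesis
    by (rule has_derivative_transform_within_open[OF _ open_interior p])
      (simp add: f subsetD[OF interior_subset])
qed

section \<open>The flux of the exact solution\<close>

text \<open>
  The factor \<open>R - L\<close> splits off the difference of the last two terms, because both are values of one
  quadratic function; what remains is linear in \<open>b\<close> and \<open>c\<close>.
\<close>

lemma flux_identity:
  fixes X L R Y Z a b c :: real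
  shows "(R - L) * (b * (1 / 2 - (X + L + R) / 3 + (L + R - 2 * X) / 6) + c * ((Z - Y) / 6)) =
    (R - L) * (a + b * ((X + L + R) / 3) + c * (Y + 2 * Z) / 3) +
    (1 - 2 * ((X + R) / 2)) * (a + b * ((X + R) / 2) + c * ((Y + Z) / 2)) -
    (1 - 2 * ((X + L) / 2)) * (a + b * ((X + L) / 2) + c * ((Y + Z) / 2))"
proof -
  have *: "(1 - 2 * q) * (a + b * q + w) - (1 - 2 * p) * (a + b * p + w) =
      (2 * q - 2 * p) * (b * (1 / 2 - (p + q)) - a - w)" for p q w :: real
    by (simp add: algebra_simps)
  have "b * (1 / 2 - (X + L + R) / 3 + (L + R - 2 * X) / 6) + c * ((Z - Y) / 6) =
      (a + b * ((X + L + R) / 3) + c * (Y + 2 * Z) / 3) +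
      (b * (1 / 2 - ((X + L) / 2 + (X + R) / 2)) - a - c * ((Y + Z) / 2))"
  proof -
    have "1 / 2 - (X + L + R) / 3 + (L + R - 2 * X) / 6 = (X + L + R) / 3 + (1 / 2 - ((X + L) / 2 + (X + R) / 2))"
      by (simp add: field_simps)
    then have "b * (1 / 2 - (X + L + R) / 3 + (L + R - 2 * X) / 6) =
        b * ((X + L + R) / 3) + b * (1 / 2 - ((X + L) / 2 + (X + R) / 2))"
      by (simp only: distrib_left)
    moreover have "c * ((Z - Y) / 6) = c * (Y + 2 * Z) / 3 - c * ((Y + Z) / 2)"
      by (simp add: field_simps)
    ultimately show ?thesis by linarith
  qed
  moreover have "2 * ((X + R) / 2) - 2 * ((X + L) / 2) = R - L" by (simp add: field_simps)
  ultimately show ?thesis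
    using *[of "(X + R) / 2" "c * ((Y + Z) / 2)" "(X + L) / 2"] by (simp only: distrib_left)
qed

definition left_mid :: "nat \<Rightarrow> nat \<Rightarrow> real \<times> real" where
  "left_mid k i = midpoint (gx i, y_apex k i) (x_left i, y_base k i)"
definition right_mid :: "nat \<Rightarrow> nat \<Rightarrow> real \<times> real" where
  "right_mid k i = midpoint (gx i, y_apex k i) (x_right i, y_base k i)"
text \<open>
  The flux of \<open>\<nabla>u = (1/2 - x, 0)\<close> from left to right through a slanted or vertical edge with midpoint \<open>p\<close>: such an
  edge has vertical extent \<open>1/(2m)\<close>, and an affine integrand may be evaluated at the midpoint.
\<close>

definition flux :: "real \<times> real \<Rightarrow> real" where
  "flux p = (1 / 2 - fst p) / (2 * real m)"
text \<open>
  The value at the centroid of the Raviart-Thomas field with divergence \<open>-1\<close> that has the flux of \<open>\<nabla>u\<close>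
  through each edge. Its first component is that of the gradient of the interpolant up to a term that vanishes when the
  triangle is isosceles.
\<close>

definition mean_flux :: "nat \<Rightarrow> nat \<Rightarrow> real \<times> real" where
  "mean_flux k i = (1 / 2 - x_centroid i + (x_left i + x_right i - 2 * gx i) / 6,
     (y_base k i - y_apex k i) / 6)"

text \<open>
  Green's formula \<open>(\<tau>, \<nabla>v)\<^sub>T = (1, v)\<^sub>T + \<integral> v \<tau>\<cdot>\<nu>\<close> for \<open>v = a + b x + c y\<close>. The base contributes nothing, being
  horizontal.
\<close>

lemma local_flux_balance:
  assumes i: "i \<le> 2 * n"
  shows "area i * ((b, c) \<bullet> mean_flux k i) =
    area i * (a + b * x_centroid i + c * (y_apex k i + 2 * y_base k i) / 3) +
    flux (right_mid k i) * (a + b * fst (right_mid k i) + c * snd (right_mid k i)) -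
    flux (left_mid k i) * (a + b * fst (left_mid k i) + c * snd (left_mid k i))"
proof -
  have mp: "real m \<noteq> 0" using m_pos by simp
  define X L R where "X = gx i" and "L = x_left i" and "R = x_right i"
  define Y Z where "Y = y_apex k i" and "Z = y_base k i"
  \<comment> \<open>the factor \<open>4 m\<close> clears the denominators of the area and of the flux\<close>
  have "4 * real m * (area i * ((b, c) \<bullet> mean_flux k i)) =
     4 * real m * (area i * (a + b * x_centroid i + c * (y_apex k i + 2 * y_base k i) / 3)) +
     4 * real m * (flux (right_mid k i) * (a + b * fst (right_mid k i) + c * snd (right_mid k i))) -
     4 * real m * (flux (left_mid k i) * (a + b * fst (left_mid k i) + c * snd (left_mid k i)))"
  proof -
    have ar: "4 * real m * (area i * z) = (R - L) * z" for z
      using mp by (simp add: area_def R_def L_def)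
    have fl: "4 * real m * (flux p * z) = (1 - 2 * fst p) * z" for p z
      using mp by (simp add: flux_def field_simps)
    have co: "fst (right_mid k i) = (X + R) / 2" "snd (right_mid k i) = (Y + Z) / 2"
       "fst (left_mid k i) = (X + L) / 2" "snd (left_mid k i) = (Y + Z) / 2"
      by (simp_all add: right_mid_def left_mid_def midpoint_def X_def R_def L_def Y_def Z_def)
    show ?thesis
      unfolding ar fl co mean_flux_def x_centroid_def
      unfolding X_def[symmetric] R_def[symmetric] L_def[symmetric] Y_def[symmetric] Z_def[symmetric]
      using flux_identity[of R L b X c Z Y a] by (simp only: inner_prod_def fst_conv snd_conv inner_real_def)
  qed
  then have "4 * real m * (area i * ((b, c) \<bullet> mean_flux k i)) =
     4 * real m * (area i * (a + b * x_centroid i + c * (y_apex k i + 2 * y_base k i) / 3) +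
       flux (right_mid k i) * (a + b * fst (right_mid k i) + c * snd (right_mid k i)) -
       flux (left_mid k i) * (a + b * fst (left_mid k i) + c * snd (left_mid k i)))"
    by (simp only: distrib_left right_diff_distrib)
  with mp show ?thesis by simp
qed

text \<open>
  The right edge of a triangle is the left edge of its neighbour, where \<open>v\<close> has the same midpoint
  value from both sides. The two ends of the row lie on \<open>x = 0\<close> and \<open>x = 1\<close>, where \<open>v\<close> vanishes at the midpoints.
\<close>

lemma row_flux_cancels:
  assumes v: "v \<in> nonconforming_P1 n m" and k: "k < 2 * m"
  shows "(\<Sum>i\<le>2 * n. flux (right_mid k i) * v (tri k i) (right_mid k i) -
      flux (left_mid k i) * v (tri k i) (left_mid k i)) = 0"
proof -
  define l where "l i = flux (left_mid k i) * v (tri k i) (left_mid k i)" for i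
  define r where "r i = flux (right_mid k i) * v (tri k i) (right_mid k i)" for i
  have np: "real n \<ge> 1" "real m \<ge> 1" using n_pos m_pos by auto
  have lateral: "v (tri k i) (midpoint a b) = 0"
    if "i \<le> 2 * n" "closed_segment a b edge_of tri k i" "fst a = z" "fst b = z" "z = 0 \<or> z = 1" for i a b z
  proof -
    have "convex ({z} \<times> (UNIV :: real set))" by (intro convex_Times) auto
    then have "closed_segment a b \<subseteq> {z} \<times> UNIV"
      using that by (intro closed_segment_subset) (auto simp: mem_Times_iff)
    then show ?thesis
      using v that k unfolding nonconforming_P1_def vanishes_at_lateral_midpoints_def
      using tri_in_triangulation by blast
  qed
  have l0: "l 0 = 0"
    using lateral[of 0 "(gx 0, y_apex k 0)" "(x_left 0, y_base k 0)" 0]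
    by (simp add: l_def left_mid_def edge_of_tri_iff) (simp add: gx_def x_left_def)
  have rN: "r (2 * n) = 0"
    using np lateral[of "2 * n" "(gx (2 * n), y_apex k (2 * n))" "(x_right (2 * n), y_base k (2 * n))" 1]
    by (simp add: r_def right_mid_def edge_of_tri_iff) (simp add: gx_def x_right_def)
  have step: "r i = l (Suc i)" if i: "i < 2 * n" for i
  proof -
    let ?a = "(gx i, y_apex k i)" and ?b = "(gx (Suc i), y_base k i)"
    have R: "x_right i = gx (Suc i)" using i by (simp add: x_right_def)
    have L: "x_left (Suc i) = gx i" by (simp add: x_left_def)
    have ya: "y_apex k (Suc i) = y_base k i" "y_base k (Suc i) = y_apex k i"
      by (simp_all add: y_apex_def y_base_def)
    have rm: "right_mid k i = midpoint ?a ?b" by (simp add: right_mid_def R)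
    have lm: "left_mid k (Suc i) = midpoint ?a ?b"
      by (simp add: left_mid_def L ya midpoint_sym)
    have cont: "continuous_at_interior_midpoints n m v"
      using v by (simp add: nonconforming_P1_def)
    have e1: "closed_segment ?a ?b edge_of tri k i"
      using i by (simp add: edge_of_tri_iff R)
    have e2: "closed_segment ?a ?b edge_of tri k (Suc i)"
      using i by (simp add: edge_of_tri_iff L ya insert_commute)
    have "midpoint ?a ?b \<in> interior unit_square"
    proof -
      have "y_apex k i + y_base k i = (2 * real k + 1) / (2 * real m)"
        by (auto simp: y_apex_def y_base_def hy_def add_divide_distrib)
      moreover have "0 < (2 * real k + 1) / (2 * real m)" using np by simp
      moreover have "(2 * real k + 1) / (2 * real m) < 2"
        using np k by (simp add: divide_less_eq)
      ultimately have y: "0 < y_apex k i + y_base k i" "y_apex k i + y_base k i < 2" by simp_all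
      have "gx i + gx (Suc i) = (2 * real i + 1) / (2 * real n)"
        by (simp add: gx_def add_divide_distrib)
      moreover have "0 < (2 * real i + 1) / (2 * real n)" using np by simp
      moreover have "(2 * real i + 1) / (2 * real n) < 2"
        using np i by (simp add: divide_less_eq)
      ultimately have x: "0 < gx i + gx (Suc i)" "gx i + gx (Suc i) < 2" by simp_all
      show ?thesis
        using x y by (simp add: interior_unit_square midpoint_def)
    qed
    then have "\<not> closed_segment ?a ?b \<subseteq> frontier unit_square"
      using midpoint_in_closed_segment[of ?a ?b] unfolding frontier_def by blast
    then have "v (tri k i) (midpoint ?a ?b) = v (tri k (Suc i)) (midpoint ?a ?b)"
      using cont e1 e2 tri_in_triangulation[OF k, of i] tri_in_triangulation[OF k, of "Suc i"] i
      unfolding continuous_at_interior_midpoints_def by (meson Suc_leI less_imp_le_nat)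
    then show ?thesis by (simp add: r_def l_def rm lm)
  qed
  have "(\<Sum>i\<le>2 * n. r i) = (\<Sum>i<2 * n. r i) + r (2 * n)"
    unfolding lessThan_Suc_atMost[symmetric] sum.lessThan_Suc ..
  also have "\<dots> = l 0 + (\<Sum>i<2 * n. l (Suc i))"
    using step l0 rN by simp
  also have "\<dots> = (\<Sum>i\<le>2 * n. l i)"
    by (simp add: sum.atMost_shift)
  finally show ?thesis by (simp add: r_def l_def sum_subtractf)
qed

lemma mids_in_tri: "left_mid k i \<in> tri k i" "right_mid k i \<in> tri k i"
  unfolding left_mid_def right_mid_def tri_def
  by (intro subsetD[OF closed_segment_subset midpoint_in_closed_segment] convex_convex_hull hull_inc;
      simp)+

lemma mean_flux_load:
  assumes v: "v \<in> nonconforming_P1 n m"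
    and aff: "\<And>k i p. k < 2 * m \<Longrightarrow> i \<le> 2 * n \<Longrightarrow> p \<in> tri k i \<Longrightarrow>
      v (tri k i) p = a k i + b k i * fst p + c k i * snd p"
  shows "(\<Sum>k<2 * m. \<Sum>i\<le>2 * n. area i * ((b k i, c k i) \<bullet> mean_flux k i)) =
    (\<Sum>k<2 * m. \<Sum>i\<le>2 * n. integral (tri k i) (v (tri k i)))"
proof (rule sum.cong[OF refl])
  fix k assume "k \<in> {..<2 * m}"
  then have k: "k < 2 * m" by simp
  have "area i * ((b k i, c k i) \<bullet> mean_flux k i) = integral (tri k i) (v (tri k i)) +
     (flux (right_mid k i) * v (tri k i) (right_mid k i) - flux (left_mid k i) * v (tri k i) (left_mid k i))"
    if i: "i \<le> 2 * n" for i
  proof -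
    have "integral (tri k i) (v (tri k i)) =
        integral (tri k i) (\<lambda>p. a k i + b k i * fst p + c k i * snd p)"
      by (intro integral_cong aff k i)
    also have "\<dots> = area i * (a k i + b k i * x_centroid i + c k i * (y_apex k i + 2 * y_base k i) / 3)"
      by (rule integral_unique[OF has_integral_affine_tri[OF i]])
    finally show ?thesis
      unfolding local_flux_balance[OF i, of "b k i" "c k i" k "a k i"]
      by (simp only: aff[OF k i mids_in_tri(1)] aff[OF k i mids_in_tri(2)])
  qed
  then show "(\<Sum>i\<le>2 * n. area i * ((b k i, c k i) \<bullet> mean_flux k i)) =
      (\<Sum>i\<le>2 * n. integral (tri k i) (v (tri k i)))"
    using row_flux_cancels[OF v k] by (simp add: sum.distrib)
qed

lemma width_bound: "i \<le> 2 * n \<Longrightarrow> x_right i - x_left i \<le> 1 / real n"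
  using gx_minus_left[of i] right_minus_gx[of i] n_pos
  by (auto simp: of_bool_def field_simps split: if_splits)

lemma total_area: "(\<Sum>k<2 * m. \<Sum>i\<le>2 * n. area i) \<le> 3 / 2"
proof -
  have np: "real n \<ge> 1" "real m \<ge> 1" using n_pos m_pos by auto
  have "area i \<le> 1 / (4 * real n * real m)" if "i \<le> 2 * n" for i
  proof -
    have "area i \<le> 1 / real n / (4 * real m)"
      unfolding area_def using np by (intro divide_right_mono width_bound that) simp
    then show ?thesis by (simp add: mult_ac)
  qed
  then have "(\<Sum>k<2 * m. \<Sum>i\<le>2 * n. area i) \<le> (\<Sum>k<2 * m. \<Sum>i\<le>2 * n. 1 / (4 * real n * real m))"
    by (intro sum_mono) auto
  also have "\<dots> = (2 * real n + 1) / (2 * real n)"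
    using np by (simp add: field_simps)
  also have "\<dots> \<le> 3 / 2" using np by (simp add: field_simps)
  finally show ?thesis .
qed

lemma mean_flux_minus_interpolant_slope:
  assumes i: "i \<le> 2 * n"
  shows "(norm (mean_flux k i - (1 / 2 - x_centroid i, 0)))\<^sup>2 \<le> 1 / (72 * (real n)\<^sup>2)"
proof -
  have np: "real n \<ge> 1" "real m \<ge> real n" using n_pos n_le_m by auto
  define \<delta> where "\<delta> = (x_left i + x_right i - 2 * gx i) / 6"
  define \<eta> where "\<eta> = (y_base k i - y_apex k i) / 6"
  have "\<bar>\<delta>\<bar> \<le> 1 / (12 * real n)"
    using gx_minus_left[of i] right_minus_gx[OF i] np
    by (auto simp: \<delta>_def of_bool_def abs_le_iff field_simps split: if_splits)
  then have "\<delta>\<^sup>2 \<le> (1 / (12 * real n))\<^sup>2"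
    using np by (intro abs_le_square_iff[THEN iffD1]) simp
  moreover have "\<bar>\<eta>\<bar> \<le> 1 / (12 * real n)"
  proof -
    have "\<bar>y_base k i - y_apex k i\<bar> = 1 / (2 * real m)"
      using np by (auto simp: y_base_def y_apex_def hy_def field_simps)
    also have "\<dots> \<le> 1 / (2 * real n)" using np by (simp add: field_simps)
    finally show ?thesis by (simp add: \<eta>_def)
  qed
  then have "\<eta>\<^sup>2 \<le> (1 / (12 * real n))\<^sup>2"
    using np by (intro abs_le_square_iff[THEN iffD1]) simp
  moreover have "mean_flux k i - (1 / 2 - x_centroid i, 0) = (\<delta>, \<eta>)"
    by (simp add: mean_flux_def \<delta>_def \<eta>_def)
  ultimately show ?thesis
    using np by (simp add: norm_Pair real_sqrt_pow2 power_divide power_mult_distrib field_simps)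
qed

text \<open>
  With \<open>e = w - interpolant\<close>, the Galerkin equation and \<open>mean_flux_load\<close> give
  \<open>(\<nabla>w, \<nabla>e) = (1, e) = (\<tau>, \<nabla>e)\<close>. Hence \<open>|e|\<^sup>2\<close> equals the product of \<open>\<tau> - \<nabla>interpolant\<close> with \<open>\<nabla>e\<close>, and Young's
  inequality absorbs \<open>\<nabla>e\<close>.
\<close>

lemma galerkin_minus_interpolant:
  assumes w: "galerkin_solution n m w"
    and aff: "\<And>k i p. k < 2 * m \<Longrightarrow> i \<le> 2 * n \<Longrightarrow> p \<in> tri k i \<Longrightarrow>
      w (tri k i) p = a k i + b k i * fst p + c k i * snd p"
  shows "(\<Sum>k<2 * m. \<Sum>i\<le>2 * n. area i * (norm (b k i - (1 / 2 - x_centroid i), c k i))\<^sup>2)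
    \<le> 1 / (48 * (real n)\<^sup>2)"
proof -
  have wV: "w \<in> nonconforming_P1 n m" using w by (simp add: galerkin_solution_def)
  define e where "e = (\<lambda>T p. w T p - interpolant T p)"
  have eV: "e \<in> nonconforming_P1 n m"
    unfolding e_def by (rule nonconforming_P1_diff[OF wV interpolant_in_nonconforming_P1])
  define \<beta> where "\<beta> k i = b k i - (1 / 2 - x_centroid i)" for k i
  define \<alpha> where "\<alpha> k i = a k i - (gx i * x_left i + x_left i * x_right i + x_right i * gx i) / 6" for k i
  have e_aff: "e (tri k i) p = \<alpha> k i + \<beta> k i * fst p + c k i * snd p"
    if "k < 2 * m" "i \<le> 2 * n" "p \<in> tri k i" for k i p
    using that aff[OF that]
    by (simp add: e_def interpolant_def column_tri Let_def \<alpha>_def \<beta>_def algebra_simps)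
  let ?S = "\<lambda>f. \<Sum>k<2 * m. \<Sum>i\<le>2 * n. area i * f k i"
  have "?S (\<lambda>k i. (b k i, c k i) \<bullet> (\<beta> k i, c k i)) = broken_H1_form n m w e"
    unfolding broken_H1_form_def sum_triangulation
  proof (intro sum.cong refl)
    fix k i assume "k \<in> {..<2 * m}" "i \<in> {..2 * n}"
    then have ki: "k < 2 * m" "i \<le> 2 * n" by auto
    have "grad (w (tri k i)) p \<bullet> grad (e (tri k i)) p = (b k i, c k i) \<bullet> (\<beta> k i, c k i)"
      if "p \<in> interior (tri k i)" for p
      using grad_eqI[OF has_derivative_affine_tri[OF aff[OF ki] that]]
        grad_eqI[OF has_derivative_affine_tri[OF e_aff[OF ki] that]] by simp
    then show "area i * ((b k i, c k i) \<bullet> (\<beta> k i, c k i)) =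
        integral (tri k i) (\<lambda>p. grad (w (tri k i)) p \<bullet> grad (e (tri k i)) p)"
      by (intro integral_const_interior_tri[symmetric] ki)
  qed
  also have "\<dots> = (\<Sum>k<2 * m. \<Sum>i\<le>2 * n. integral (tri k i) (e (tri k i)))"
    using w eV by (simp add: galerkin_solution_def sum_triangulation)
  also have "\<dots> = ?S (\<lambda>k i. (\<beta> k i, c k i) \<bullet> mean_flux k i)"
    by (rule mean_flux_load[OF eV e_aff, symmetric])
  finally have orth: "?S (\<lambda>k i. (b k i, c k i) \<bullet> (\<beta> k i, c k i)) = ?S (\<lambda>k i. (\<beta> k i, c k i) \<bullet> mean_flux k i)" .
  have young: "p \<bullet> q \<le> ((norm p)\<^sup>2 + (norm q)\<^sup>2) / 2" for p q :: "real \<times> real"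
    using inner_ge_zero[of "p - q"]
    by (simp add: power2_norm_eq_inner inner_diff_left inner_diff_right inner_commute)
  let ?\<tau> = "\<lambda>k i. mean_flux k i - (1 / 2 - x_centroid i, 0)"
  let ?E = "?S (\<lambda>k i. (norm (\<beta> k i, c k i))\<^sup>2)"
  have "?E = ?S (\<lambda>k i. (b k i, c k i) \<bullet> (\<beta> k i, c k i)) -
      ?S (\<lambda>k i. (\<beta> k i, c k i) \<bullet> (1 / 2 - x_centroid i, 0))"
    unfolding sum_subtractf[symmetric] right_diff_distrib[symmetric] power2_norm_eq_inner
    by (intro sum.cong refl arg_cong2[of _ _ _ _ "(*)"]) (simp add: \<beta>_def algebra_simps)
  also have "\<dots> = ?S (\<lambda>k i. (\<beta> k i, c k i) \<bullet> ?\<tau> k i)"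
    unfolding orth by (simp add: sum_subtractf[symmetric] right_diff_distrib[symmetric] inner_diff_right)
  also have "\<dots> \<le> ?S (\<lambda>k i. ((norm (\<beta> k i, c k i))\<^sup>2 + 1 / (72 * (real n)\<^sup>2)) / 2)"
  proof (intro sum_mono mult_left_mono)
    fix k i assume "i \<in> {..2 * n}"
    then have i: "i \<le> 2 * n" by simp
    show "(\<beta> k i, c k i) \<bullet> ?\<tau> k i \<le> ((norm (\<beta> k i, c k i))\<^sup>2 + 1 / (72 * (real n)\<^sup>2)) / 2"
      by (rule order_trans[OF young divide_right_mono[OF add_left_mono]])
        (use mean_flux_minus_interpolant_slope[OF i] in simp_all)
    show "0 \<le> area i" using area_pos[OF i] by simp
  qed
  also have "\<dots> = ?E / 2 + (\<Sum>k<2 * m. \<Sum>i\<le>2 * n. area i) * (1 / (144 * (real n)\<^sup>2))"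
    by (simp add: sum_distrib_left sum_distrib_right sum_divide_distrib sum.distrib
        distrib_left add_divide_distrib)
  finally have "?E \<le> (\<Sum>k<2 * m. \<Sum>i\<le>2 * n. area i) * (1 / (72 * (real n)\<^sup>2))" by simp
  also have "\<dots> \<le> 3 / 2 * (1 / (72 * (real n)\<^sup>2))"
    by (intro mult_right_mono total_area) simp
  finally show ?thesis by (simp add: \<beta>_def)
qed

section \<open>The error bound\<close>

lemma error_bound:
  assumes u: "poisson_solution u" and w: "galerkin_solution n m w"
  shows "broken_H1_seminorm n m (\<lambda>T p. u p - w T p) \<le> 2 / real n"
proof -
  have np: "real n \<ge> 1" using n_pos by auto
  have "\<exists>a b c. \<forall>p\<in>tri k i. w (tri k i) p = a + b * fst p + c * snd p"
    if "k < 2 * m" "i \<le> 2 * n" for k i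
  proof -
    have "linear_poly_on (tri k i) (w (tri k i))"
      using w tri_in_triangulation[OF that] by (simp add: galerkin_solution_def nonconforming_P1_def)
    then obtain a b c where "\<forall>(x, y)\<in>tri k i. w (tri k i) (x, y) = a + b * x + c * y"
      unfolding linear_poly_on_def by blast
    then show ?thesis by (intro exI[of _ a] exI[of _ b] exI[of _ c]) auto
  qed
  then obtain a b c where aff: "\<And>k i p. k < 2 * m \<Longrightarrow> i \<le> 2 * n \<Longrightarrow> p \<in> tri k i \<Longrightarrow>
      w (tri k i) p = a k i + b k i * fst p + c k i * snd p"
    by metis
  define E where "E k i = (norm (b k i - (1 / 2 - x_centroid i), c k i))\<^sup>2" for k i
  have local: "integral (tri k i) (\<lambda>p. (norm (grad (\<lambda>p. u p - w (tri k i) p) p))\<^sup>2)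
      \<le> area i * (2 / (real n)\<^sup>2 + 2 * E k i)" if ki: "k < 2 * m" "i \<le> 2 * n" for k i
  proof (rule integral_bound_interior_tri[OF ki(2)])
    fix p assume p: "p \<in> interior (tri k i)"
    obtain x y where p_eq: "p = (x, y)" by (cases p)
    have lv: "level k i y < 1" "\<bar>2 * real n * x - real i\<bar> < level k i y" and x: "0 < x" "x < 1"
      using p mem_interior_tri[OF ki(2)] by (auto simp: p_eq)
    have "(u has_derivative (\<lambda>h. h \<bullet> (1 / 2 - x, 0))) (at p)"
      using has_derivative_parabola[of u p] poisson_solution_unique[OF u] x by (auto simp: p_eq)
    from has_derivative_diff[OF this has_derivative_affine_tri[OF aff[OF ki] p]]
    have "((\<lambda>p. u p - w (tri k i) p) has_derivative
        (\<lambda>h. h \<bullet> ((1 / 2 - x, 0) - (b k i, c k i)))) (at p)"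
      by (simp only: inner_diff_right)
    from grad_eqI[OF this]
    have g: "grad (\<lambda>p. u p - w (tri k i) p) p = (1 / 2 - x - b k i, - c k i)" by simp
    define d where "d = x_centroid i - x"
    define \<beta> where "\<beta> = b k i - (1 / 2 - x_centroid i)"
    have "\<bar>d\<bar> \<le> 1 / real n"
    proof -
      have "\<bar>2 * real n * x - real i\<bar> \<le> 1" using lv by linarith
      then have "\<bar>x - gx i\<bar> \<le> 1 / (2 * real n)"
        using np by (simp add: gx_def abs_le_iff field_simps)
      moreover have "\<bar>x_centroid i - gx i\<bar> \<le> 1 / (2 * real n)"
        using gx_minus_left[of i] right_minus_gx[OF ki(2)] np
        by (auto simp: x_centroid_def of_bool_def abs_le_iff field_simps split: if_splits)
      ultimately show ?thesis unfolding d_def by (simp add: abs_le_iff field_simps)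
    qed
    then have "d\<^sup>2 \<le> (1 / real n)\<^sup>2"
      using np by (intro abs_le_square_iff[THEN iffD1]) simp
    then have "2 * d\<^sup>2 \<le> 2 / (real n)\<^sup>2" by (simp add: power_divide)
    moreover have "(d - \<beta>)\<^sup>2 \<le> 2 * d\<^sup>2 + 2 * \<beta>\<^sup>2"
      using zero_le_power2[of "d + \<beta>"] by (simp add: power2_eq_square algebra_simps)
    moreover have "(norm (grad (\<lambda>p. u p - w (tri k i) p) p))\<^sup>2 = (d - \<beta>)\<^sup>2 + (c k i)\<^sup>2"
      by (simp add: g norm_Pair d_def \<beta>_def algebra_simps)
    moreover have "E k i = \<beta>\<^sup>2 + (c k i)\<^sup>2"
      by (simp add: E_def norm_Pair \<beta>_def)
    ultimately show "(norm (grad (\<lambda>p. u p - w (tri k i) p) p))\<^sup>2 \<le> 2 / (real n)\<^sup>2 + 2 * E k i"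
      using zero_le_power2[of "c k i"] by linarith
  qed (simp add: E_def)
  have "(\<Sum>T\<in>triangulation n m. integral T (\<lambda>p. (norm (grad (\<lambda>p. u p - w T p) p))\<^sup>2))
      \<le> (\<Sum>k<2 * m. \<Sum>i\<le>2 * n. area i * (2 / (real n)\<^sup>2 + 2 * E k i))"
    unfolding sum_triangulation using local by (intro sum_mono) auto
  also have "\<dots> = (\<Sum>k<2 * m. \<Sum>i\<le>2 * n. area i) * (2 / (real n)\<^sup>2) +
      2 * (\<Sum>k<2 * m. \<Sum>i\<le>2 * n. area i * E k i)"
    by (simp add: sum_distrib_left sum_distrib_right sum.distrib distrib_left mult_ac)
  also have "\<dots> \<le> 3 / 2 * (2 / (real n)\<^sup>2) + 2 * (1 / (48 * (real n)\<^sup>2))"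
    unfolding E_def using galerkin_minus_interpolant[OF w aff]
    by (intro add_mono mult_right_mono mult_left_mono total_area) auto
  also have "\<dots> \<le> (2 / real n)\<^sup>2"
    using np by (simp add: power_divide field_simps)
  finally show ?thesis
    unfolding broken_H1_seminorm_def using np by (intro real_le_lsqrt) auto
qed

end

theorem mainTheorem2:
  shows "(\<forall>u. poisson_solution u \<longleftrightarrow> (\<forall>x\<in>{0..1}. \<forall>y. u (x, y) = 1 / 2 * x * (1 - x))) \<and>
    (\<exists>C::real. \<forall>u. poisson_solution u \<longrightarrow>
       (\<forall>n m u_nm. 1 \<le> n \<longrightarrow> n \<le> m \<longrightarrow> galerkin_solution n m u_nm \<longrightarrow>
          broken_H1_seminorm n m (\<lambda>T p. u p - u_nm T p) \<le> C / real n))"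
proof (intro conjI allI exI[of _ 2] impI)
  fix u show "poisson_solution u \<longleftrightarrow> (\<forall>x\<in>{0..1}. \<forall>y. u (x, y) = 1 / 2 * x * (1 - x))"
    by (rule poisson_solution_iff)
next
  fix u n m u_nm
  assume u: "poisson_solution u" and "1 \<le> n" "n \<le> m" and w: "galerkin_solution n m u_nm"
  then interpret mesh n m by unfold_locales
  show "broken_H1_seminorm n m (\<lambda>T p. u p - u_nm T p) \<le> 2 / real n"
    by (rule error_bound[OF u w])
qed

end
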